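(* Let $w$ be the permutation matrix of size $r\ge 2$ attached to $\pi\in\mathfrak S_r$, and let $wn$, $wu$, $T_i^L$, $F_i^L$ be as in the context. Let $T_i$ and $F_i$ be the square submatrices of $wu$ of size $i$ defined by $$T_i=\bigl((wu)_{k,\ell}\bigr)_{k,\ell\ge r-i+1},\qquad F_i=\bigl((wu)_{k,\ell}\bigr)_{k\ge r-i,\ k\ne r-i+1;\ \ell\ge r-i+1}.$$ Assume that $1\le i\le r$ satisfies $r-i+1>\pi(r)$, so that the bottom row of $T_i$ and $F_i$ does not contain the $1$-entry in the bottom row of $wu$, which is in the $\pi(r)$-th column. (i) We have $$\det(T_i)=(-1)^{s+i}\cdot u_{\pi(r-i+s),r}\cdot\det(T_i^L),$$ where $s$ is such that the $(r-i+s)$-th row of $wn$ coincides (in position) with the row of $T_i$ that contains the highest nonzero entry of the rightmost column of $T_i$. (ii) We have $$\det(F_i)=\begin{cases}\dfrac{1}{n_{\pi(r-i+1),r}}\det(T_i)-\dfrac{(-1)^i}{n_{\pi(r-i+1),r}}\cdot u_{\pi(r-i+2),r}\cdot\det(F_i^L) & \text{if } r-i+1>\pi^{-1}(r),\\[2mm] (-1)^i\cdot u_{\pi(r-i+2),r}\cdot\det(F_i^L) & \text{if } r-i+1=\pi^{-1}(r),\\[1mm] (-1)^{r-\pi^{-1}(r)}\cdot\det(F_i^L) & \text{if } r-i+1<\pi^{-1}(r).\end{cases}$$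
   Context: **The matrix $wn$.** Let $r\ge 2$, $\pi\in\mathfrak S_r$, and let $w$ be the $r\times r$ permutation matrix with $w_{i,j}=1$ if $j=\pi(i)$ and $0$ otherwise. Put $Inv(\pi^{-1})=\{(a,b): a<b,\ \pi^{-1}(a)>\pi^{-1}(b)\}$. Let $V_w=\{n_{a,b}: (a,b)\in Inv(\pi^{-1})\}$ be a set of independent indeterminates (the *free variables* ); put $n_{a,a}=1$, and $n_{a,b}=0$ for all other pairs. Let $wn$ be the $r\times r$ matrix with $(i,j)$ entry $n_{\pi(i),j}$; so $n_{a,b}$ sits in row $\pi^{-1}(a)$ and column $b$. Denote by $1_j$ the entry $n_{j,j}=1$ of $wn$ in column $j$ (it is in row $\pi^{-1}(j)$). Entries are distinguished by position; the nonzero entries are the $1_j$ and the free variables. All identities are in the Laurent polynomial ring $\mathbb Z[\{n_\alpha,n_\alpha^{-1}: n_\alpha\in V_w\}]$. **Paths.** Two nonzero entries of $wn$ are neighbors if they are in the same row or the same column with no other nonzero entry between them. A path from one nonzero entry to another is a sequence of nonzero entries, consecutive ones being neighbors, moving only by upward and leftward steps; its length is the number of entries minus $1$ (length $0$ is allowed). Paths are disjoint if they share no entry. For sets $A,B$ of nonzero entries with $|A|=|B|=m\ge1$, $\mathcal P(A\to B)$ is the collection of all sets of $m$ pairwise disjoint paths connecting the elements of $A$ bijectively to the elements of $B$. For a set $\mathbf p$ of disjoint paths, $u(\mathbf p)$ is the product of all free variables traversed by its paths, and $P(A\to B)=\sum_{\mathbf p\in\mathcal P(A\to B)}u(\mathbf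 p)$. $\mathcal P_L(A\to B)\subseteq\mathcal P(A\to B)$ consists of the sets in which every path of length at least $1$ whose origin is in the rightmost ($r$-th) column of $wn$ starts by going left, and $P_L(A\to B)=\sum_{\mathbf p\in\mathcal P_L(A\to B)}u(\mathbf p)$. $\rho(1_j)$ is the product of the nonzero entries in the row of $wn$ containing $1_j$. **Origins, destinations, the map $R$.** For $n_{a,b}\in V_w$ let $M_w(n_{a,b})$ be the submatrix of $wn$ with rows $\pi^{-1}(b),\dots,\pi^{-1}(a)$ and columns $b,\dots,r$. $D(n_{a,b})$ is the set of $1$-entries in $M_w(n_{a,b})$ (it contains $1_b$). $O(n_{a,b})$ consists of the rightmost nonzero entry of the bottom row of $M_w(n_{a,b})$, together with the rightmost nonzero entries of the rows of $M_w(n_{a,b})$ containing an element of $D(n_{a,b})$ other than $1_b$. One has $|O(n_{a,b})|=|D(n_{a,b})|$. Let $P(n_\alpha)=P(O(n_\alpha)\to D(n_\alpha))$, $P_L(n_\alpha)=P_L(O(n_\alpha)\to D(n_\alpha))$, $t_\alpha=|D(n_\alpha)|-1$, $$R(n_\alpha)=(-1)^{t_\alpha}\frac{P(n_\alpha)}{\prod_{1_\mu\in D(n_\alpha)}\rho(1_\mu)},\qquad R_L(n_\alpha)=(-1)^{t_\alpha}\frac{P_L(n_\alpha)}{\prod_{1_\mu\in D(n_\alpha)}\rho(1_\mu)}.$$ Put $u_{a,b}=R(n_{a,b})$ if $n_{a,b}\in V_w$ and $u_{a,b}=n_{a,b}\in\{0,1\}$ otherwise; $wu$ is the matrix with entries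 $(wu)_{k,b}=u_{\pi(k),b}$. Thus $wu$ is obtained from $wn$ by replacing each free variable $n_\alpha$ by $u_\alpha$, and rows of $wn$ and $wu$ correspond by position. **The matrices $T_i^L$, $F_i^L$.** For $k\ge r-i$, $k\neq\pi^{-1}(r)$, let $x_k^L$ be the row vector of length $i-1$ with entries $x_k^L(b)$, $r-i+1\le b\le r-1$, where $x_k^L(b)=R_L(n_{\pi(k),b})$ if $(\pi(k),b)\in Inv(\pi^{-1})$ and $x_k^L(b)=u_{\pi(k),b}$ otherwise. $T_i^L$ is the $(i-1)\times(i-1)$ matrix whose rows are, in increasing order of index: $x^L_{r-i+2},\dots,x^L_r$ if $r-i+1>\pi^{-1}(r)$; and $x^L_k$ for $r-i+1\le k\le r$, $k\ne\pi^{-1}(r)$, if $r-i+1\le\pi^{-1}(r)$. $F_i^L$ is the $(i-1)\times(i-1)$ matrix whose rows are: $x^L_{r-i+1},x^L_{r-i+3},\dots,x^L_r$ (indices $r-i+1$ and then $r-i+3$ through $r$) if $r-i+1>\pi^{-1}(r)$; $x^L_{r-i},x^L_{r-i+3},\dots,x^L_r$ (indices $r-i$ and then $r-i+3$ through $r$) if $r-i+1=\pi^{-1}(r)$; and $x^L_{r-i}$ followed by $x^L_k$ for $r-i+2\le k\le r$, $k\neq\pi^{-1}(r)$, if $r-i+1<\pi^{-1}(r)$. *)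

theory Defs
  imports
    "HOL-Combinatorics.Permutations"
    "HOL-Library.Poly_Mapping"
    "Jordan_Normal_Form.Determinant"
begin

text \<open>
  Laurent polynomials with integer coefficients are the group ring of the free abelian group of
  exponent vectors. The indeterminates are indexed by all of \<open>nat \<times> nat\<close>; only those with index in
  the inversion set are ever used, so everything lives in the subring
  \<open>\<int>[{n\<^sub>\<alpha>, n\<^sub>\<alpha>\<inverse>. n\<^sub>\<alpha> \<in> V\<^sub>w}]\<close>.
\<close>

type_synonym laurent = "((nat \<times> nat) \<Rightarrow>\<^sub>0 int) \<Rightarrow>\<^sub>0 int"

definition laurent_var :: "nat \<Rightarrow> nat \<Rightarrow> laurent" where
  "laurent_var a b = Poly_Mapping.single (Poly_Mapping.single (a, b) 1) 1"

text \<open>The inverse of a unit; it is only applied to Laurent monomials.\<close>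

definition unit_inv :: "'a::comm_ring_1 \<Rightarrow> 'a" where
  "unit_inv y = (THE z. y * z = 1)"

lemma unit_inv_eq:
  assumes "y * z = 1"
  shows "unit_inv y = z"
  unfolding unit_inv_def
proof (rule the_equality[of _ z])
  fix z' assume "y * z' = 1"
  then show "z' = z"
    using assms by (metis mult.assoc mult.commute mult.right_neutral)
qed (fact assms)

lemma laurent_var_mult_inverse:
  "laurent_var a b * Poly_Mapping.single (Poly_Mapping.single (a, b) (-1)) 1 = 1"
  by (simp add: laurent_var_def mult_single flip: single_add single_one)

text \<open>
  The inverse permutation; the notation \<open>inv\<close> is taken by the inverse in a group.
\<close>

abbreviation pinv :: "(nat \<Rightarrow> nat) \<Rightarrow> nat \<Rightarrow> nat" where
  "pinv \<pi> \<equiv> inv_into UNIV \<pi>"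

text \<open>
  Rows and columns are numbered from \<open>1\<close> to \<open>r\<close>. A permutation of \<open>{1..r}\<close> is a function with
  \<open>\<pi> permutes {1..r}\<close>, hence the identity outside \<open>{1..r}\<close>. \<open>Inv r \<pi>\<close> is the inversion set of
  \<open>\<pi>\<inverse>\<close>.
\<close>

definition Inv :: "nat \<Rightarrow> (nat \<Rightarrow> nat) \<Rightarrow> (nat \<times> nat) set" where
  "Inv r \<pi> = {(a, b). a \<in> {1..r} \<and> b \<in> {1..r} \<and> a < b \<and> pinv \<pi> a > pinv \<pi> b}"

definition n_entry :: "nat \<Rightarrow> (nat \<Rightarrow> nat) \<Rightarrow> nat \<Rightarrow> nat \<Rightarrow> laurent" where
  "n_entry r \<pi> a b = (if (a, b) \<in> Inv r \<pi> then laurent_var a b else if a = b then 1 else 0)"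

definition wn :: "nat \<Rightarrow> (nat \<Rightarrow> nat) \<Rightarrow> nat \<Rightarrow> nat \<Rightarrow> laurent" where
  "wn r \<pi> k l = n_entry r \<pi> (\<pi> k) l"

text \<open>
  Entries of \<open>wn\<close> are identified with their positions \<open>(row, column)\<close>; \<open>one_pos \<pi> j\<close> is the
  position of \<open>1\<^sub>j\<close>.
\<close>

definition entries :: "nat \<Rightarrow> (nat \<Rightarrow> nat) \<Rightarrow> (nat \<times> nat) set" where
  "entries r \<pi> = {(k, l). k \<in> {1..r} \<and> l \<in> {1..r} \<and> wn r \<pi> k l \<noteq> 0}"

definition free_pos :: "nat \<Rightarrow> (nat \<Rightarrow> nat) \<Rightarrow> (nat \<times> nat) set" where
  "free_pos r \<pi> = {(k, l). k \<in> {1..r} \<and> l \<in> {1..r} \<and> (\<pi> k, l) \<in> Inv r \<pi>}"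

definition one_pos :: "(nat \<Rightarrow> nat) \<Rightarrow> nat \<Rightarrow> nat \<times> nat" where
  "one_pos \<pi> j = (pinv \<pi> j, j)"

definition neighbors :: "nat \<Rightarrow> (nat \<Rightarrow> nat) \<Rightarrow> nat \<times> nat \<Rightarrow> nat \<times> nat \<Rightarrow> bool" where
  "neighbors r \<pi> p q \<longleftrightarrow> p \<in> entries r \<pi> \<and> q \<in> entries r \<pi> \<and> p \<noteq> q \<and>
     (fst p = fst q \<and>
        (\<forall>l. min (snd p) (snd q) < l \<and> l < max (snd p) (snd q) \<longrightarrow> (fst p, l) \<notin> entries r \<pi>) \<or>
      snd p = snd q \<and>
        (\<forall>k. min (fst p) (fst q) < k \<and> k < max (fst p) (fst q) \<longrightarrow> (k, snd p) \<notin> entries r \<pi>))"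

definition left_step :: "nat \<times> nat \<Rightarrow> nat \<times> nat \<Rightarrow> bool" where
  "left_step p q \<longleftrightarrow> fst q = fst p \<and> snd q < snd p"

definition up_step :: "nat \<times> nat \<Rightarrow> nat \<times> nat \<Rightarrow> bool" where
  "up_step p q \<longleftrightarrow> snd q = snd p \<and> fst q < fst p"

definition is_path :: "nat \<Rightarrow> (nat \<Rightarrow> nat) \<Rightarrow> (nat \<times> nat) list \<Rightarrow> bool" where
  "is_path r \<pi> ps \<longleftrightarrow> ps \<noteq> [] \<and> set ps \<subseteq> entries r \<pi> \<and>
     successively (\<lambda>p q. neighbors r \<pi> p q \<and> (up_step p q \<or> left_step p q)) ps"

text \<open>The collections \<open>\<P>(A \<rightarrow> B)\<close> and \<open>\<P>\<^sub>L(A \<rightarrow> B)\<close>.\<close>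

definition path_systems ::
    "nat \<Rightarrow> (nat \<Rightarrow> nat) \<Rightarrow> (nat \<times> nat) set \<Rightarrow> (nat \<times> nat) set \<Rightarrow> (nat \<times> nat) list set set" where
  "path_systems r \<pi> A B = {S. (\<forall>ps\<in>S. is_path r \<pi> ps) \<and>
     (\<forall>ps\<in>S. \<forall>qs\<in>S. ps \<noteq> qs \<longrightarrow> set ps \<inter> set qs = {}) \<and>
     bij_betw hd S A \<and> bij_betw last S B}"

definition path_systems_L ::
    "nat \<Rightarrow> (nat \<Rightarrow> nat) \<Rightarrow> (nat \<times> nat) set \<Rightarrow> (nat \<times> nat) set \<Rightarrow> (nat \<times> nat) list set set" where
  "path_systems_L r \<pi> A B = {S \<in> path_systems r \<pi> A B.
     \<forall>ps\<in>S. length ps \<ge> 2 \<and> snd (hd ps) = r \<longrightarrow> left_step (ps ! 0) (ps ! 1)}"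

definition path_weight :: "nat \<Rightarrow> (nat \<Rightarrow> nat) \<Rightarrow> (nat \<times> nat) list set \<Rightarrow> laurent" where
  "path_weight r \<pi> S = (\<Prod>ps\<in>S. \<Prod>(k, l) \<in> set ps \<inter> free_pos r \<pi>. wn r \<pi> k l)"

definition P_sum ::
    "nat \<Rightarrow> (nat \<Rightarrow> nat) \<Rightarrow> (nat \<times> nat) set \<Rightarrow> (nat \<times> nat) set \<Rightarrow> laurent" where
  "P_sum r \<pi> A B = (\<Sum>S\<in>path_systems r \<pi> A B. path_weight r \<pi> S)"

definition PL_sum ::
    "nat \<Rightarrow> (nat \<Rightarrow> nat) \<Rightarrow> (nat \<times> nat) set \<Rightarrow> (nat \<times> nat) set \<Rightarrow> laurent" where
  "PL_sum r \<pi> A B = (\<Sum>S\<in>path_systems_L r \<pi> A B. path_weight r \<pi> S)"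

text \<open>The two sums above range over finite sets, so they are not \<open>0\<close> by convention.\<close>

lemma finite_entries: "finite (entries r \<pi>)"
  by (rule finite_subset[of _ "{1..r} \<times> {1..r}"]) (auto simp: entries_def)

lemma is_path_distinct:
  assumes "is_path r \<pi> ps"
  shows "distinct ps"
proof -
  let ?R = "\<lambda>p q :: nat \<times> nat. fst q + snd q < fst p + snd p"
  have "successively ?R ps"
    using assms unfolding is_path_def
    by (auto elim!: successively_mono simp: up_step_def left_step_def)
  then have "sorted_wrt ?R ps"
    by (subst (asm) successively_iff_sorted_wrt_strong) (auto intro: less_trans)
  then show ?thesis
    by (induction ps) auto
qed

lemma finite_path_systems:
  "finite (path_systems r \<pi> A B)" "finite (path_systems_L r \<pi> A B)"
proof -
  have "finite {ps. set ps \<subseteq> entries r \<pi> \<and> distinct ps}"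
    by (rule finite_subset_distinct[OF finite_entries])
  then have "finite {ps. is_path r \<pi> ps}"
    by (rule rev_finite_subset) (auto simp: is_path_distinct, auto simp: is_path_def)
  moreover have "path_systems r \<pi> A B \<subseteq> Pow {ps. is_path r \<pi> ps}"
    by (auto simp: path_systems_def)
  ultimately show *: "finite (path_systems r \<pi> A B)"
    using finite_subset by blast
  show "finite (path_systems_L r \<pi> A B)"
    by (rule finite_subset[OF _ *]) (auto simp: path_systems_L_def)
qed

text \<open>\<open>\<rho>(1\<^sub>j)\<close>, as a function of the position of \<open>1\<^sub>j\<close>.\<close>

definition rho :: "nat \<Rightarrow> (nat \<Rightarrow> nat) \<Rightarrow> nat \<times> nat \<Rightarrow> laurent" where
  "rho r \<pi> p = (\<Prod>l \<in> {l. (fst p, l) \<in> entries r \<pi>}. wn r \<pi> (fst p) l)"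

text \<open>
  Below, \<open>a\<close> and \<open>b\<close> are the indices of a free variable \<open>n\<^sub>a\<^sub>b\<close>; \<open>M_pos\<close> gives the positions, in
  \<open>wn\<close>, of the submatrix \<open>M\<^sub>w(n\<^sub>a\<^sub>b)\<close>.
\<close>

definition M_pos :: "nat \<Rightarrow> (nat \<Rightarrow> nat) \<Rightarrow> nat \<Rightarrow> nat \<Rightarrow> (nat \<times> nat) set" where
  "M_pos r \<pi> a b = {pinv \<pi> b..pinv \<pi> a} \<times> {b..r}"

definition D_set :: "nat \<Rightarrow> (nat \<Rightarrow> nat) \<Rightarrow> nat \<Rightarrow> nat \<Rightarrow> (nat \<times> nat) set" where
  "D_set r \<pi> a b = one_pos \<pi> ` {1..r} \<inter> M_pos r \<pi> a b"

definition rightmost_in_M :: "nat \<Rightarrow> (nat \<Rightarrow> nat) \<Rightarrow> nat \<Rightarrow> nat \<Rightarrow> nat \<Rightarrow> nat \<times> nat" where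
  "rightmost_in_M r \<pi> a b k = (k, Max {l. (k, l) \<in> entries r \<pi> \<inter> M_pos r \<pi> a b})"

definition O_set :: "nat \<Rightarrow> (nat \<Rightarrow> nat) \<Rightarrow> nat \<Rightarrow> nat \<Rightarrow> (nat \<times> nat) set" where
  "O_set r \<pi> a b = insert (rightmost_in_M r \<pi> a b (pinv \<pi> a))
     (rightmost_in_M r \<pi> a b ` fst ` (D_set r \<pi> a b - {one_pos \<pi> b}))"

definition R_map :: "nat \<Rightarrow> (nat \<Rightarrow> nat) \<Rightarrow> nat \<Rightarrow> nat \<Rightarrow> laurent" where
  "R_map r \<pi> a b = (-1) ^ (card (D_set r \<pi> a b) - 1) *
     P_sum r \<pi> (O_set r \<pi> a b) (D_set r \<pi> a b) * unit_inv (\<Prod>p\<in>D_set r \<pi> a b. rho r \<pi> p)"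

definition RL_map :: "nat \<Rightarrow> (nat \<Rightarrow> nat) \<Rightarrow> nat \<Rightarrow> nat \<Rightarrow> laurent" where
  "RL_map r \<pi> a b = (-1) ^ (card (D_set r \<pi> a b) - 1) *
     PL_sum r \<pi> (O_set r \<pi> a b) (D_set r \<pi> a b) * unit_inv (\<Prod>p\<in>D_set r \<pi> a b. rho r \<pi> p)"

definition u_entry :: "nat \<Rightarrow> (nat \<Rightarrow> nat) \<Rightarrow> nat \<Rightarrow> nat \<Rightarrow> laurent" where
  "u_entry r \<pi> a b = (if (a, b) \<in> Inv r \<pi> then R_map r \<pi> a b else n_entry r \<pi> a b)"

definition wu :: "nat \<Rightarrow> (nat \<Rightarrow> nat) \<Rightarrow> nat \<Rightarrow> nat \<Rightarrow> laurent" where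
  "wu r \<pi> k l = u_entry r \<pi> (\<pi> k) l"

definition xL :: "nat \<Rightarrow> (nat \<Rightarrow> nat) \<Rightarrow> nat \<Rightarrow> nat \<Rightarrow> laurent" where
  "xL r \<pi> k b = (if (\<pi> k, b) \<in> Inv r \<pi> then RL_map r \<pi> (\<pi> k) b else u_entry r \<pi> (\<pi> k) b)"

text \<open>
  \<open>mat_on A ks ls\<close> has rows \<open>ks\<close> and columns \<open>ls\<close> of the array \<open>A\<close>. Matrices of type \<open>'a mat\<close> are
  indexed from \<open>0\<close>.
\<close>

definition mat_on :: "(nat \<Rightarrow> nat \<Rightarrow> 'a) \<Rightarrow> nat list \<Rightarrow> nat list \<Rightarrow> 'a mat" where
  "mat_on A ks ls = mat (length ks) (length ls) (\<lambda>(p, q). A (ks ! p) (ls ! q))"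

definition T_mat :: "nat \<Rightarrow> (nat \<Rightarrow> nat) \<Rightarrow> nat \<Rightarrow> laurent mat" where
  "T_mat r \<pi> i = mat_on (wu r \<pi>) [r - i + 1..<r + 1] [r - i + 1..<r + 1]"

definition F_mat :: "nat \<Rightarrow> (nat \<Rightarrow> nat) \<Rightarrow> nat \<Rightarrow> laurent mat" where
  "F_mat r \<pi> i = mat_on (wu r \<pi>) [k \<leftarrow> [r - i..<r + 1]. k \<noteq> r - i + 1] [r - i + 1..<r + 1]"

definition TL_mat :: "nat \<Rightarrow> (nat \<Rightarrow> nat) \<Rightarrow> nat \<Rightarrow> laurent mat" where
  "TL_mat r \<pi> i = mat_on (xL r \<pi>)
     (if r - i + 1 > pinv \<pi> r then [r - i + 2..<r + 1]
      else [k \<leftarrow> [r - i + 1..<r + 1]. k \<noteq> pinv \<pi> r])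
     [r - i + 1..<r]"

text \<open>
  For \<open>i = 1\<close> the description of the rows of \<open>F\<^sub>i\<^sup>L\<close> degenerates: a \<open>0 \<times> 0\<close> matrix cannot contain the
  row \<open>r - i + 1\<close>. This is harmless, since \<open>det F\<^sub>i\<^sup>L\<close> is then multiplied by the entry of index
  \<open>(\<pi> (r + 1), r) = (r + 1, r)\<close>, which is \<open>0\<close> (there is no row \<open>r + 1\<close>, and \<open>u_entry\<close> is \<open>0\<close> there).
\<close>

definition FL_mat :: "nat \<Rightarrow> (nat \<Rightarrow> nat) \<Rightarrow> nat \<Rightarrow> laurent mat" where
  "FL_mat r \<pi> i = mat_on (xL r \<pi>)
     (if r - i + 1 > pinv \<pi> r then (r - i + 1) # [r - i + 3..<r + 1]
      else if r - i + 1 = pinv \<pi> r then (r - i) # [r - i + 3..<r + 1]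
      else (r - i) # [k \<leftarrow> [r - i + 2..<r + 1]. k \<noteq> pinv \<pi> r])
     [r - i + 1..<r]"

text \<open>
  The index \<open>s\<close>, counted from \<open>1\<close>, of the row of \<open>T\<^sub>i\<close> containing the highest nonzero entry of its
  rightmost column.
\<close>

definition top_row :: "nat \<Rightarrow> (nat \<Rightarrow> nat) \<Rightarrow> nat \<Rightarrow> nat" where
  "top_row r \<pi> i = (LEAST s. 1 \<le> s \<and> s \<le> i \<and> T_mat r \<pi> i $$ (s - 1, i - 1) \<noteq> 0)"

end

theory Submission
  imports Defs
begin

text \<open>
  The \<open>1\<close>-entries are the sinks of the graph of upward and leftward steps on the nonzero entries of
  \<open>wn\<close>. Call \<open>h\<close> harmonic if \<open>h(x) = n\<^sub>x (h(left x) \<plusminus> h(up x))\<close> at every free variable \<open>x\<close>, where the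
  sign counts the rows skipped by the vertical step. For fixed \<open>b\<close>, column \<open>b\<close> of \<open>wu\<close> consists of
  the values, at the right ends of the rows, of the harmonic function \<open>h\<^sub>b\<close> obtained by letting one
  origin in the definition of \<open>R(n\<^sub>a\<^sub>b)\<close> vary over all entries. It vanishes at \<open>1\<^sub>c\<close> for \<open>c < b\<close> and
  equals \<open>1 / \<rho>(1\<^sub>b)\<close> at \<open>1\<^sub>b\<close>. The same holds for \<open>R\<^sub>L\<close> and the graph without vertical steps in the last
  column.

  Subtracting \<open>n\<^sub>\<pi>\<^sub>(\<^sub>k\<^sub>)\<^sub>,\<^sub>r\<close> times the row above from each row \<open>k\<close> below \<open>1\<^sub>r\<close> clears the last column of \<open>wu\<close>
  and makes the other columns harmonic for the smaller graph. These columns and those of the vectors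
  \<open>x\<^sup>L\<^sub>k\<close> are then expressed through the Green function of the smaller graph by triangular matrices with
  the same diagonal, so all corresponding minors agree. Expanding \<open>det T\<^sub>i\<close> and \<open>det F\<^sub>i\<close> along the last
  column gives the formulas.
\<close>

subsection \<open>Systems of disjoint paths in a ranked graph\<close>

locale ranked_graph =
  fixes E :: "'v \<Rightarrow> 'v \<Rightarrow> bool" and rk :: "'v \<Rightarrow> nat" and V :: "'v set"
    and wt :: "'v \<Rightarrow> 'a::comm_ring_1"
  assumes finite_V: "finite V"
    and E_V: "E p q \<Longrightarrow> q \<in> V"
    and E_rk: "E p q \<Longrightarrow> rk q < rk p"
begin

definition paths :: "'v list set" where
  "paths = {ps. ps \<noteq> [] \<and> set ps \<subseteq> V \<and> successively E ps}"

definition systems :: "'v set \<Rightarrow> 'v set \<Rightarrow> 'v list set set" where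
  "systems A B = {S. S \<subseteq> paths \<and> (\<forall>ps\<in>S. \<forall>qs\<in>S. ps \<noteq> qs \<longrightarrow> set ps \<inter> set qs = {}) \<and>
     bij_betw hd S A \<and> bij_betw last S B}"

definition weight :: "'v list set \<Rightarrow> 'a" where
  "weight S = (\<Prod>ps\<in>S. \<Prod>p\<in>set ps. wt p)"

definition total :: "'v set \<Rightarrow> 'v set \<Rightarrow> 'a" where
  "total A B = (\<Sum>S\<in>systems A B. weight S)"

lemma path_le_hd:
  fixes f :: "'v \<Rightarrow> nat"
  assumes f: "\<And>p q. E p q \<Longrightarrow> f q \<le> f p" and "successively E ps" and "x \<in> set ps"
  shows "f x \<le> f (hd ps)"
  using assms(2,3)
proof (induction ps)
  case (Cons p ps)
  then show ?case
    by (cases ps) (auto dest!: f)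
qed simp

lemma path_less_hd:
  assumes "successively E (p # ps)" and "x \<in> set ps"
  shows "rk x < rk p"
proof -
  obtain q qs where ps: "ps = q # qs"
    using assms(2) by (cases ps) auto
  have "rk x \<le> rk (hd ps)"
    using assms ps by (intro path_le_hd less_imp_le[OF E_rk]) auto
  with assms ps E_rk[of p q] show ?thesis
    by auto
qed

lemma path_distinct: "successively E ps \<Longrightarrow> distinct ps"
proof (induction ps)
  case (Cons p ps)
  then show ?case
    using path_less_hd[of p ps p] by (auto simp: successively_Cons)
qed simp

lemma finite_paths: "finite paths"
proof (rule finite_subset)
  show "paths \<subseteq> {ps. set ps \<subseteq> V \<and> distinct ps}"
    by (auto simp: paths_def path_distinct)
qed (rule finite_subset_distinct[OF finite_V])

lemma finite_systems: "finite (systems A B)"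
  by (rule finite_subset[of _ "Pow paths"]) (auto simp: systems_def finite_paths)

lemma finite_system: "S \<in> systems A B \<Longrightarrow> finite S"
  using finite_paths by (auto simp: systems_def intro: finite_subset)

text \<open>A system is in bijection with both its sources and its destinations. The typical
  application is to coinciding sources: as a set they merge, and the total vanishes.\<close>

lemma total_card_neq:
  assumes "card A \<noteq> card B"
  shows "total A B = 0"
proof -
  have "systems A B = {}"
    using assms by (auto simp: systems_def) (metis bij_betw_same_card)
  then show ?thesis by (simp add: total_def)
qed

lemma total_eq_0_source:
  fixes f :: "'v \<Rightarrow> nat"
  assumes f: "\<And>p q. E p q \<Longrightarrow> f q \<le> f p" and "a \<in> A" and "\<And>b. b \<in> B \<Longrightarrow> f a < f b"
  shows "total A B = 0"
proof -
  have False if S: "S \<in> systems A B" for S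
  proof -
    obtain ps where ps: "ps \<in> S" "hd ps = a"
      using S assms(2) by (auto simp: systems_def bij_betw_def)
    then have "ps \<in> paths" "last ps \<in> B"
      using S by (auto simp: systems_def bij_betw_def)
    then show False
      using path_le_hd[of f ps "last ps"] f ps assms(3) by (fastforce simp: paths_def)
  qed
  then have "systems A B = {}" by blast
  then show ?thesis by (simp add: total_def)
qed

lemma total_eq_0_sink:
  fixes f :: "'v \<Rightarrow> nat"
  assumes f: "\<And>p q. E p q \<Longrightarrow> f q \<le> f p" and "b \<in> B" and "\<And>a. a \<in> A \<Longrightarrow> f a < f b"
  shows "total A B = 0"
proof -
  have False if S: "S \<in> systems A B" for S
  proof -
    have "b \<in> last ` S"
      using S assms(2) by (simp add: systems_def bij_betw_def)
    then obtain ps where ps: "ps \<in> S" "last ps = b" by blast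
    then have "ps \<in> paths" "hd ps \<in> A"
      using S by (auto simp: systems_def bij_betw_def)
    then show False
      using path_le_hd[of f ps "last ps"] f ps assms(3) by (fastforce simp: paths_def)
  qed
  then have "systems A B = {}" by blast
  then show ?thesis by (simp add: total_def)
qed

text \<open>Systems are sorted by the path that starts at \<open>v\<close>; removing it leaves a
  system for the remaining ends that avoids it.\<close>

lemma total_split:
  assumes "v \<in> A"
  shows "total A B = (\<Sum>(ps, S) \<in> {(ps, S). ps \<in> paths \<and> hd ps = v \<and> last ps \<in> B \<and>
    S \<in> systems (A - {v}) (B - {last ps}) \<and> (\<forall>qs\<in>S. set ps \<inter> set qs = {})}.
    (\<Prod>p\<in>set ps. wt p) * weight S)"
    (is "_ = (\<Sum>(ps, S) \<in> ?T. _)")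
proof -
  define g where "g S = (THE ps. ps \<in> S \<and> hd ps = v)" for S :: "'v list set"
  \<comment> \<open>A member \<open>ps\<close> of \<open>S\<close> would have to be disjoint from
    itself, but paths are nonempty.\<close>
  have notin: "ps \<notin> S" if "(ps, S) \<in> ?T" for ps S
    using that by (auto simp: paths_def)
  have sys: "insert ps S \<in> systems A B" if T: "(ps, S) \<in> ?T" for ps S
  proof -
    have "bij_betw hd (insert ps S) (insert v (A - {v}))"
      using T notin[OF T] by (intro bij_betw_combine[of _ "{_}" "{_}", simplified]) (auto simp: systems_def)
    moreover have "bij_betw last (insert ps S) (insert (last ps) (B - {last ps}))"
      using T notin[OF T] by (intro bij_betw_combine[of _ "{_}" "{_}", simplified]) (auto simp: systems_def)
    ultimately show ?thesis
      using T assms by (fastforce simp: systems_def insert_absorb)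
  qed
  have g: "g S \<in> S" "hd (g S) = v" if "S \<in> systems A B" for S
  proof -
    have bij: "bij_betw hd S A" using that by (simp add: systems_def)
    then have "\<exists>!ps. ps \<in> S \<and> hd ps = v"
      using assms unfolding bij_betw_def inj_on_def by blast
    then have "g S \<in> S \<and> hd (g S) = v"
      unfolding g_def by (rule theI')
    then show "g S \<in> S" "hd (g S) = v" by auto
  qed
  have g_eq: "g S = ps" if "S \<in> systems A B" "ps \<in> S" "hd ps = v" for S ps
    using that g[of S] by (auto simp: systems_def bij_betw_def inj_on_def)
  have "(\<Sum>(ps, S) \<in> ?T. (\<Prod>p\<in>set ps. wt p) * weight S) = (\<Sum>S\<in>systems A B. weight S)"
  proof (rule sum.reindex_bij_witness[where j = "\<lambda>(ps, S). insert ps S" and i = "\<lambda>S. (g S, S - {g S})"])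
    fix x assume x: "x \<in> ?T"
    then obtain ps S where [simp]: "x = (ps, S)" by force
    from x have ps: "g (insert ps S) = ps"
      by (intro g_eq sys) auto
    show "(g (case x of (ps, S) \<Rightarrow> insert ps S), (case x of (ps, S) \<Rightarrow> insert ps S) - {g (case x of (ps, S) \<Rightarrow> insert ps S)}) = x"
      using ps notin[of ps S] x by auto
    show "(case x of (ps, S) \<Rightarrow> insert ps S) \<in> systems A B"
      using sys[of ps S] x by auto
    have "finite S" using x finite_system by auto
    then show "weight (case x of (ps, S) \<Rightarrow> insert ps S) = (case x of (ps, S) \<Rightarrow> (\<Prod>p\<in>set ps. wt p) * weight S)"
      using notin[of ps S] x by (auto simp: weight_def)
  next
    fix S assume S: "S \<in> systems A B"
    show "(case (g S, S - {g S}) of (ps, S) \<Rightarrow> insert ps S) = S"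
      using g[OF S] by auto
    have "bij_betw hd (S - {g S}) (A - {hd (g S)})" "bij_betw last (S - {g S}) (B - {last (g S)})"
      using S g[OF S] by (auto intro!: bij_betw_DiffI simp: systems_def) (auto simp: bij_betw_def)
    moreover have "last (g S) \<in> B"
      using g[OF S] S by (auto simp: systems_def bij_betw_def)
    ultimately show "(g S, S - {g S}) \<in> ?T"
      using S g[OF S] by (auto simp: systems_def)
  qed
  then show ?thesis by (simp add: total_def)
qed

text \<open>The path from the sink \<open>x\<close> is \<open>[x]\<close>. All other sources lie
  below \<open>x\<close> in \<open>f\<close>, so no other path can run into it, and the trivial path
  splits off as a factor.\<close>

lemma total_sink:
  fixes f :: "'v \<Rightarrow> nat"
  assumes f: "\<And>p q. E p q \<Longrightarrow> f q \<le> f p" and "x \<in> V" and "\<And>q. \<not> E x q"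
    and "x \<notin> B" and "\<And>a. a \<in> A \<Longrightarrow> f a < f x"
  shows "total (insert x A) (insert x B) = wt x * total A B"
proof -
  have xA: "insert x A - {x} = A" "insert x B - {x} = B"
    using assms(4,5) by auto
  have avoid: "x \<notin> set qs" if "qs \<in> S" "S \<in> systems A B" for qs S
  proof
    assume "x \<in> set qs"
    moreover have "hd qs \<in> A" "successively E qs"
      using that by (auto simp: systems_def paths_def bij_betw_def)
    ultimately show False
      using path_le_hd[of f qs x] assms(5)[of "hd qs"] f by fastforce
  qed
  have single: "ps = [x]" if "ps \<in> paths" "hd ps = x" for ps
    using that assms(3) by (cases ps; cases "tl ps") (auto simp: paths_def)
  have "[x] \<in> paths"
    using assms(2) by (simp add: paths_def)
  have "{(ps, S). ps \<in> paths \<and> hd ps = x \<and> last ps \<in> insert x B \<and>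
    S \<in> systems (insert x A - {x}) (insert x B - {last ps}) \<and> (\<forall>qs\<in>S. set ps \<inter> set qs = {})} =
    Pair [x] ` systems A B" (is "?T = _")
  proof (intro equalityI subsetI)
    fix y assume "y \<in> ?T"
    then obtain ps S where y: "y = (ps, S)" "(ps, S) \<in> ?T" by blast
    then have "ps = [x]" using single by blast
    with y show "y \<in> Pair [x] ` systems A B" by (simp add: xA)
  next
    fix y assume "y \<in> Pair [x] ` systems A B"
    then obtain S where "y = ([x], S)" "S \<in> systems A B" by blast
    then show "y \<in> ?T" using avoid \<open>[x] \<in> paths\<close> by (simp add: xA)
  qed
  then show ?thesis
    by (subst total_split[of x]) (simp_all add: sum.reindex inj_on_def total_def sum_distrib_left)
qed

text \<open>Since \<open>v\<close> is not a destination, its path has a first step, which moves the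
  source to a successor \<open>q\<close>. The maximal rank of \<open>v\<close> guarantees that no
  other path meets \<open>v\<close>, so prepending \<open>v\<close> again keeps the paths
  disjoint.\<close>

lemma total_peel:
  assumes "finite A" and "card A = card B" and "v \<in> A" and "v \<notin> B" and "v \<in> V"
    and "\<And>a. a \<in> A \<Longrightarrow> rk a \<le> rk v"
  shows "total A B = wt v * (\<Sum>q\<in>{q. E v q}. total (insert q (A - {v})) B)"
proof -
  define U where "U q = {(ps, S). ps \<in> paths \<and> hd ps = q \<and> last ps \<in> B \<and>
    S \<in> systems (A - {v}) (B - {last ps}) \<and> (\<forall>qs\<in>S. set ps \<inter> set qs = {})}" for q
  define W where "W = (\<lambda>(ps :: 'v list, S). (\<Prod>p\<in>set ps. wt p) * weight S)"
  have fin: "finite (U q)" for q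
    by (rule finite_subset[of _ "paths \<times> (\<Union>ps\<in>paths. systems (A - {v}) (B - {last ps}))"])
       (auto simp: U_def finite_paths finite_systems)
  have U_total: "sum W (U q) = total (insert q (A - {v})) B" if "E v q" for q
  proof (cases "q \<in> A - {v}")
    \<comment> \<open>The successor is already a source: no path from it is disjoint from the rest,
      and the merged source set has the wrong cardinality, so both sides are 0.\<close>
    case True
    have "card (insert q (A - {v})) \<noteq> card B"
      using True card.remove[OF assms(1,3)] assms(2) by (simp add: insert_absorb)
    moreover have "U q = {}"
    proof -
      have False if "(ps, S) \<in> U q" for ps S
      proof -
        have "q \<in> hd ` S" using that True by (auto simp: U_def systems_def bij_betw_def)
        then obtain qs where "qs \<in> S" "hd qs = q" by blast
        then have "q \<in> set qs" using that by (auto simp: U_def systems_def paths_def)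
        moreover have "q \<in> set ps" using that by (auto simp: U_def paths_def)
        ultimately show False using that \<open>qs \<in> S\<close> by (auto simp: U_def)
      qed
      then show ?thesis by auto
    qed
    ultimately show ?thesis by (simp add: total_card_neq)
  next
    case False
    then have "insert q (A - {v}) - {q} = A - {v}" by blast
    then show ?thesis
      by (subst total_split[of q]) (auto simp: U_def W_def)
  qed
  have avoid: "v \<notin> set qs" if "qs \<in> S" "S \<in> systems (A - {v}) B'" for qs S B'
  proof
    assume v: "v \<in> set qs"
    have "hd qs \<in> A - {v}" "qs \<in> paths"
      using that by (auto simp: systems_def bij_betw_def)
    then obtain p ps where "qs = p # ps" "p \<noteq> v" "p \<in> A" "successively E (p # ps)"
      by (cases qs) (auto simp: paths_def)
    then show False
      using path_less_hd[of p ps v] v assms(6)[of p] by auto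
  qed
  let ?T = "{(ps, S). ps \<in> paths \<and> hd ps = v \<and> last ps \<in> B \<and>
    S \<in> systems (A - {v}) (B - {last ps}) \<and> (\<forall>qs\<in>S. set ps \<inter> set qs = {})}"
  have T: "?T = (\<lambda>(ps, S). (v # ps, S)) ` (\<Union>q\<in>{q. E v q}. U q)" (is "_ = ?R")
  proof (intro equalityI subsetI)
    fix x assume "x \<in> ?T"
    then obtain ps S where x: "x = (ps, S)" "(ps, S) \<in> ?T" by blast
    then obtain q qs where ps: "ps = v # q # qs"
      using \<open>v \<notin> B\<close> by (cases ps; cases "tl ps") (auto simp: paths_def)
    then have "(q # qs, S) \<in> U q" "E v q"
      using x by (auto simp: U_def paths_def)
    then show "x \<in> ?R" using x ps by force
  next
    fix x assume "x \<in> ?R"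
    then obtain q ps S where x: "x = (v # ps, S)" "(ps, S) \<in> U q" "E v q" by auto
    then show "x \<in> ?T"
      using avoid[of _ S "B - {last ps}"] \<open>v \<in> V\<close>
      by (auto simp: U_def paths_def successively_Cons)
  qed
  have "total A B = sum W ?T"
    using total_split[OF \<open>v \<in> A\<close>, of B] by (simp add: W_def)
  also have "\<dots> = (\<Sum>x\<in>(\<Union>q\<in>{q. E v q}. U q). W (case x of (ps, S) \<Rightarrow> (v # ps, S)))"
    unfolding T by (subst sum.reindex) (auto simp: inj_on_def)
  also have "\<dots> = (\<Sum>x\<in>(\<Union>q\<in>{q. E v q}. U q). wt v * W x)"
  proof (intro sum.cong refl)
    fix x assume "x \<in> (\<Union>q\<in>{q. E v q}. U q)"
    then obtain q ps S where x: "x = (ps, S)" "(ps, S) \<in> U q" "E v q"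
      by (cases x) auto
    then have "successively E (v # ps)"
      by (auto simp: U_def paths_def successively_Cons)
    then have "v \<notin> set ps"
      using path_distinct by force
    then show "W (case x of (ps, S) \<Rightarrow> (v # ps, S)) = wt v * W x"
      by (simp add: x W_def mult.assoc)
  qed
  also have "\<dots> = (\<Sum>q\<in>{q. E v q}. \<Sum>x\<in>U q. wt v * W x)"
  proof (rule sum.UNION_disjoint)
    show "finite {q. E v q}"
      by (rule finite_subset[OF _ finite_V]) (auto dest: E_V)
  qed (auto simp: fin, auto simp: U_def)
  also have "\<dots> = wt v * (\<Sum>q\<in>{q. E v q}. total (insert q (A - {v})) B)"
    by (simp add: sum_distrib_left[symmetric] U_total)
  finally show ?thesis .
qed

end

subsection \<open>The graph of nonzero entries\<close>

text \<open>
  For \<open>vert = False\<close> the vertical steps in the last column are removed from the graph, which turns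
  \<open>P\<close> into \<open>P\<^sub>L\<close>.
\<close>

locale permuted_array =
  fixes r :: nat and \<pi> :: "nat \<Rightarrow> nat" and vert :: bool
  assumes perm: "\<pi> permutes {1..r}"
begin

abbreviation "ent \<equiv> entries r \<pi>"

definition wt :: "nat \<times> nat \<Rightarrow> laurent" where
  "wt p = wn r \<pi> (fst p) (snd p)"

definition free :: "nat \<times> nat \<Rightarrow> bool" where
  "free p \<longleftrightarrow> p \<in> ent \<and> \<pi> (fst p) < snd p"

lemma pinv_simps [simp]: "pinv \<pi> (\<pi> k) = k" "\<pi> (pinv \<pi> l) = l"
  using permutes_inverses[OF perm] by auto

lemma perm_eq_iff [simp]: "\<pi> k = \<pi> l \<longleftrightarrow> k = l"
  by (metis pinv_simps(1))

lemma perm_range [simp]: "Suc 0 \<le> \<pi> k \<longleftrightarrow> Suc 0 \<le> k" "\<pi> k \<le> r \<longleftrightarrow> k \<le> r"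
  using permutes_in_image[OF perm, of k] permutes_not_in[OF perm, of k]
  by (cases "k = 0"; cases "k \<le> r"; auto)+

lemma pinv_range [simp]: "Suc 0 \<le> pinv \<pi> l \<longleftrightarrow> Suc 0 \<le> l" "pinv \<pi> l \<le> r \<longleftrightarrow> l \<le> r"
  using perm_range[of "pinv \<pi> l"] by (simp_all only: pinv_simps)

lemma laurent_var_neq_0: "laurent_var a b \<noteq> 0"
  using laurent_var_mult_inverse[of a b] by auto

text \<open>The inversion condition and the diagonal case merge because \<open>\<pi> k = l\<close>
  and \<open>pinv \<pi> l = k\<close> are equivalent. The two inequalities place the entry weakly
  right of the \<open>1\<close> in its row and weakly below the \<open>1\<close> in its
  column.\<close>

lemma entries_iff:
  "(k, l) \<in> ent \<longleftrightarrow> 1 \<le> k \<and> k \<le> r \<and> 1 \<le> l \<and> l \<le> r \<and> \<pi> k \<le> l \<and> pinv \<pi> l \<le> k"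
proof -
  have "\<pi> k < l \<and> pinv \<pi> l < k \<or> \<pi> k = l \<longleftrightarrow> \<pi> k \<le> l \<and> pinv \<pi> l \<le> k"
    by (metis le_neq_implies_less less_imp_le order_refl pinv_simps)
  then show ?thesis
    using laurent_var_neq_0
    by (auto simp: entries_def wn_def n_entry_def Inv_def)
qed

lemma wt_unit: "p \<in> ent \<Longrightarrow> \<exists>z. wt p * z = 1"
  using laurent_var_mult_inverse[of "\<pi> (fst p)" "snd p"]
  by (cases p) (auto simp: wt_def entries_def wn_def n_entry_def split: if_splits)

lemma wt_one: "wt (k, \<pi> k) = 1"
  by (simp add: wt_def wn_def n_entry_def Inv_def)

lemma one_in_entries: "1 \<le> k \<Longrightarrow> k \<le> r \<Longrightarrow> (k, \<pi> k) \<in> ent"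
  by (simp add: entries_iff)

lemma finite_row: "finite {l. (k, l) \<in> ent}" "finite {l. P l \<and> (k, l) \<in> ent}"
  by (auto intro: finite_subset[of _ "{..r}"] simp: entries_iff)

lemma finite_col: "finite {k. P k \<and> (k, l) \<in> ent}"
  by (auto intro: finite_subset[of _ "{..r}"] simp: entries_iff)

section \<open>Neighbours of an entry and the step relation\<close>

definition rend :: "nat \<Rightarrow> nat \<times> nat" where
  "rend k = (k, Max {l. (k, l) \<in> ent})"

text \<open>Here and in \<open>up\<close> the set under \<open>Max\<close> is nonempty at a free
  entry: it contains the \<open>1\<close> of the row, respectively of the column.\<close>

definition left :: "nat \<times> nat \<Rightarrow> nat \<times> nat" where
  "left p = (fst p, Max {l. l < snd p \<and> (fst p, l) \<in> ent})"

definition up :: "nat \<times> nat \<Rightarrow> nat \<times> nat" where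
  "up p = (Max {k. k < fst p \<and> (k, snd p) \<in> ent}, snd p)"

lemma fst_rend [simp]: "fst (rend k) = k"
  by (simp add: rend_def)

lemma fst_left [simp]: "fst (left p) = fst p"
  by (simp add: left_def)

lemma snd_up [simp]: "snd (up p) = snd p"
  by (simp add: up_def)

lemma rend_in: "1 \<le> k \<Longrightarrow> k \<le> r \<Longrightarrow> rend k \<in> ent"
  using Max_in[of "{l. (k, l) \<in> ent}"] one_in_entries[of k] finite_row(1)[of k]
  by (auto simp: rend_def)

lemma rend_ge: "(k, l) \<in> ent \<Longrightarrow> l \<le> snd (rend k)"
  using finite_row(1)[of k] by (auto simp: rend_def intro: Max_ge)

lemma left_props:
  assumes "free p"
  shows "left p \<in> ent" "snd (left p) < snd p" "\<pi> (fst p) \<le> snd (left p)"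
    "\<And>l. (fst p, l) \<in> ent \<Longrightarrow> l < snd p \<Longrightarrow> l \<le> snd (left p)"
proof -
  let ?S = "{l. l < snd p \<and> (fst p, l) \<in> ent}"
  have "\<pi> (fst p) \<in> ?S"
    using assms by (cases p) (auto simp: free_def entries_iff intro!: one_in_entries)
  moreover have "finite ?S" by (rule finite_row)
  ultimately have "Max ?S \<in> ?S" "\<pi> (fst p) \<le> Max ?S"
    using Max_in[of ?S] Max_ge[of ?S] by blast+
  then show "left p \<in> ent" "snd (left p) < snd p" "\<pi> (fst p) \<le> snd (left p)"
    by (auto simp: left_def)
  show "l \<le> snd (left p)" if "(fst p, l) \<in> ent" "l < snd p" for l
    using that finite_row(2) by (auto simp: left_def intro: Max_ge)
qed

lemma up_props:
  assumes "free p"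
  shows "up p \<in> ent" "fst (up p) < fst p" "pinv \<pi> (snd p) \<le> fst (up p)"
    "\<And>k. (k, snd p) \<in> ent \<Longrightarrow> k < fst p \<Longrightarrow> k \<le> fst (up p)"
proof -
  let ?S = "{k. k < fst p \<and> (k, snd p) \<in> ent}"
  have "pinv \<pi> (snd p) \<noteq> fst p"
    using assms by (metis free_def less_irrefl pinv_simps(2))
  then have "pinv \<pi> (snd p) \<in> ?S"
    using assms by (cases p) (auto simp: free_def entries_iff)
  moreover have "finite ?S" by (rule finite_col)
  ultimately have "Max ?S \<in> ?S" "pinv \<pi> (snd p) \<le> Max ?S"
    using Max_in[of ?S] Max_ge[of ?S] by blast+
  then show "up p \<in> ent" "fst (up p) < fst p" "pinv \<pi> (snd p) \<le> fst (up p)"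
    by (auto simp: up_def)
  show "k \<le> fst (up p)" if "(k, snd p) \<in> ent" "k < fst p" for k
    using that finite_col by (auto simp: up_def intro: Max_ge)
qed

definition step :: "nat \<times> nat \<Rightarrow> nat \<times> nat \<Rightarrow> bool" where
  "step p q \<longleftrightarrow> neighbors r \<pi> p q \<and> (left_step p q \<or> up_step p q \<and> (vert \<or> snd p \<noteq> r))"

text \<open>Row-major order: columns are at most \<open>r\<close>, so the row decides first. Hence
  among several sources the rightmost one in the lowest row has maximal rank and may be peeled
  off.\<close>

definition rk :: "nat \<times> nat \<Rightarrow> nat" where
  "rk p = fst p * (r + 1) + snd p"

lemma rk_less: "fst q = fst p \<Longrightarrow> snd q < snd p \<Longrightarrow> rk q < rk p"
  "q \<in> ent \<Longrightarrow> fst q < fst p \<Longrightarrow> rk q < rk p"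
proof -
  assume "q \<in> ent" "fst q < fst p"
  then have "snd q < r + 1" "fst q * (r + 1) + (r + 1) \<le> fst p * (r + 1)"
    using mult_le_mono1[of "Suc (fst q)" "fst p" "r + 1"] by (cases q; auto simp: entries_iff)+
  then show "rk q < rk p" by (simp add: rk_def)
qed (simp add: rk_def)

lemma step_fst: "step p q \<Longrightarrow> fst q \<le> fst p"
  and step_snd: "step p q \<Longrightarrow> snd q \<le> snd p"
  by (auto simp: step_def left_step_def up_step_def)

sublocale ranked_graph step rk ent wt
proof
  show "step p q \<Longrightarrow> q \<in> ent" for p q
    by (simp add: step_def neighbors_def)
  show "step p q \<Longrightarrow> rk q < rk p" for p q
    by (auto simp: step_def left_step_def up_step_def neighbors_def intro: rk_less)
qed (rule finite_entries)

lemma neighbors_row: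
  assumes "c < b"
  shows "neighbors r \<pi> (a, b) (a, c) \<longleftrightarrow>
    (a, b) \<in> ent \<and> (a, c) \<in> ent \<and> (\<forall>l. c < l \<and> l < b \<longrightarrow> (a, l) \<notin> ent)"
proof -
  have "min b c = c" "max b c = b" using assms by auto
  then show ?thesis
    unfolding neighbors_def fst_conv snd_conv using assms by simp
qed

lemma neighbors_col:
  assumes "c < a"
  shows "neighbors r \<pi> (a, b) (c, b) \<longleftrightarrow>
    (a, b) \<in> ent \<and> (c, b) \<in> ent \<and> (\<forall>k. c < k \<and> k < a \<longrightarrow> (k, b) \<notin> ent)"
proof -
  have "min a c = c" "max a c = a" using assms by auto
  then show ?thesis
    unfolding neighbors_def fst_conv snd_conv using assms by simp
qed

lemma left_step_iff:
  assumes "free p"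
  shows "neighbors r \<pi> p q \<and> left_step p q \<longleftrightarrow> q = left p"
proof
  assume q: "neighbors r \<pi> p q \<and> left_step p q"
  then have q': "fst q = fst p" "snd q < snd p"
    by (simp_all add: left_step_def)
  then have "q \<in> ent" and gap: "snd q < l \<Longrightarrow> l < snd p \<Longrightarrow> (fst p, l) \<notin> ent" for l
    using q neighbors_row[of "snd q" "snd p" "fst p"] by (cases p; cases q; simp)+
  have "(fst p, snd (left p)) \<in> ent" "(fst p, snd q) \<in> ent"
    using q'(1) \<open>q \<in> ent\<close> left_props(1)[OF assms] by (metis fst_left prod.collapse)+
  then have "snd q = snd (left p)"
    using gap[of "snd (left p)"] q'(2) left_props(2)[OF assms] left_props(4)[OF assms, of "snd q"]
    by force
  then show "q = left p"
    using q' by (simp add: prod_eq_iff)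
next
  assume q: "q = left p"
  then have gap: "\<forall>l. snd q < l \<and> l < snd p \<longrightarrow> (fst p, l) \<notin> ent"
    and "q \<in> ent" "fst q = fst p" "snd q < snd p"
    using left_props[OF assms] leD by auto
  moreover have "p \<in> ent" using assms by (simp add: free_def)
  ultimately show "neighbors r \<pi> p q \<and> left_step p q"
    by (cases p; cases q) (simp add: left_step_def neighbors_row)
qed

lemma up_step_iff:
  assumes "free p"
  shows "neighbors r \<pi> p q \<and> up_step p q \<longleftrightarrow> q = up p"
proof
  assume q: "neighbors r \<pi> p q \<and> up_step p q"
  then have q': "snd q = snd p" "fst q < fst p"
    by (simp_all add: up_step_def)
  then have "q \<in> ent" and gap: "fst q < k \<Longrightarrow> k < fst p \<Longrightarrow> (k, snd p) \<notin> ent" for k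
    using q neighbors_col[of "fst q" "fst p" "snd p"] by (cases p; cases q; simp)+
  have "(fst (up p), snd p) \<in> ent" "(fst q, snd p) \<in> ent"
    using q'(1) \<open>q \<in> ent\<close> up_props(1)[OF assms] by (metis snd_up prod.collapse)+
  then have "fst q = fst (up p)"
    using gap[of "fst (up p)"] q'(2) up_props(2)[OF assms] up_props(4)[OF assms, of "fst q"]
    by force
  then show "q = up p"
    using q' by (simp add: prod_eq_iff)
next
  assume q: "q = up p"
  then have gap: "\<forall>k. fst q < k \<and> k < fst p \<longrightarrow> (k, snd p) \<notin> ent"
    and "q \<in> ent" "snd q = snd p" "fst q < fst p"
    using up_props[OF assms] leD by auto
  moreover have "p \<in> ent" using assms by (simp add: free_def)
  ultimately show "neighbors r \<pi> p q \<and> up_step p q"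
    by (cases p; cases q) (simp add: up_step_def neighbors_col)
qed

lemma step_iff: "free p \<Longrightarrow> step p q \<longleftrightarrow> q = left p \<or> q = up p \<and> (vert \<or> snd p \<noteq> r)"
  using left_step_iff[of p q] up_step_iff[of p q] by (auto simp: step_def)

text \<open>A \<open>1\<close> is the leftmost nonzero entry of its row and the topmost of its
  column.\<close>

lemma no_step_one: "\<not> step (k, \<pi> k) q"
  by (cases q) (auto simp: step_def left_step_def up_step_def neighbors_def entries_iff)

lemma left_neq_up: "free p \<Longrightarrow> left p \<noteq> up p"
  using left_props(2)[of p] by (metis less_irrefl snd_up)

text \<open>The weight of the path that goes straight left from \<open>p\<close> to the
  \<open>1\<close> of its row; at the right end of the row it is \<open>rho\<close>.\<close>

definition row_prod :: "nat \<times> nat \<Rightarrow> laurent" where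
  "row_prod p = (\<Prod>l\<in>{l. l \<le> snd p \<and> (fst p, l) \<in> ent}. wt (fst p, l))"

lemma row_prod_free:
  assumes "free p"
  shows "row_prod p = wt p * row_prod (left p)"
proof -
  have "{l. l \<le> snd p \<and> (fst p, l) \<in> ent} = insert (snd p) {l. l \<le> snd (left p) \<and> (fst p, l) \<in> ent}"
    using left_props(2,4)[OF assms] assms by (fastforce simp: free_def)
  then show ?thesis
    using left_props(2)[OF assms] finite_row(2) by (simp add: row_prod_def)
qed

lemma row_prod_one: "1 \<le> k \<Longrightarrow> k \<le> r \<Longrightarrow> row_prod (k, \<pi> k) = 1"
proof -
  assume "1 \<le> k" "k \<le> r"
  then have "{l. l \<le> \<pi> k \<and> (k, l) \<in> ent} = {\<pi> k}"
    using one_in_entries[of k] by (auto simp: entries_iff)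
  then show ?thesis by (simp add: row_prod_def wt_one)
qed

lemma rho_eq: "rho r \<pi> (k, l) = row_prod (rend k)"
proof -
  have "{l. l \<le> snd (rend k) \<and> (k, l) \<in> ent} = {l. (k, l) \<in> ent}"
    using rend_ge by auto
  then show ?thesis by (simp add: rho_def row_prod_def wt_def)
qed

lemma entry_cases:
  assumes "p \<in> ent"
  obtains (one) "p = (fst p, \<pi> (fst p))" | (free) "free p"
  using assms by (cases p) (auto simp: free_def entries_iff le_less)

lemma step_total:
  assumes "free p" and "A \<subseteq> ent" and "p \<notin> A" and "Suc (card A) = card B" and "p \<notin> B"
    and "\<And>a. a \<in> A \<Longrightarrow> fst a < fst p \<or> fst a = fst p \<and> snd a < snd p"
  shows "total (insert p A) B = wt p * (total (insert (left p) A) B +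
    (if vert \<or> snd p \<noteq> r then total (insert (up p) A) B else 0))"
proof -
  have "finite A" using assms(2) finite_entries finite_subset by blast
  moreover have "rk a \<le> rk p" if "a \<in> insert p A" for a
    using that subsetD[OF assms(2), of a] assms(6)[of a] rk_less(1)[of a p] rk_less(2)[of a p]
    by (auto intro: less_imp_le)
  moreover have "insert p A - {p} = A" using assms(3) by auto
  moreover have "{q. step p q} = (if vert \<or> snd p \<noteq> r then {left p, up p} else {left p})"
    using assms(1) by (auto simp: step_iff)
  ultimately show ?thesis
    using assms left_neq_up[of p]
    by (subst total_peel[of _ _ p]) (auto simp: free_def)
qed

lemma total_empty: "total {} {} = 1"
proof -
  have "systems {} {} = {{}}" by (auto simp: systems_def bij_betw_def)
  then show ?thesis by (simp add: total_def weight_def)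
qed

text \<open>In its row a \<open>1\<close> can be reached only from the right, so the lowest source goes straight left.\<close>

lemma total_straight:
  assumes "p \<in> ent" and "A \<subseteq> ent" and "finite B"
    and "\<And>a. a \<in> A \<Longrightarrow> fst a < fst p" and "\<And>b. b \<in> B \<Longrightarrow> fst b < fst p"
  shows "total (insert p A) (insert (fst p, \<pi> (fst p)) B) = row_prod p * total A B"
proof (cases "card A = card B")
  case False
  have "finite A" using assms(2) finite_entries finite_subset by blast
  moreover have "p \<notin> A" "(fst p, \<pi> (fst p)) \<notin> B" using assms(4)[of p] assms(5)[of "(fst p, \<pi> (fst p))"] by auto
  ultimately show ?thesis
    using False \<open>finite B\<close> by (simp add: total_card_neq)
next
  case card: True
  have "finite A" using assms(2) finite_entries finite_subset by blast
  from assms(1,4,5) show ?thesis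
  proof (induction "snd p" arbitrary: p rule: less_induct)
    case less
    from less.prems(1) show ?case
    proof (cases rule: entry_cases)
      case one
      then have "total (insert p A) (insert p B) = wt p * total A B"
        using less.prems no_step_one[of "fst p"]
        by (intro total_sink[of fst] step_fst) (auto, metis less_irrefl)
      moreover have "row_prod p = 1" "wt p = 1"
        using one less.prems(1) row_prod_one[of "fst p"] wt_one[of "fst p"]
        by (metis entries_iff)+
      ultimately show ?thesis using one by simp
    next
      case free
      let ?B = "insert (fst p, \<pi> (fst p)) B"
      have "card ?B = Suc (card A)"
        using card less.prems(3) \<open>finite B\<close> by (subst card_insert_disjoint) force+
      moreover have "p \<notin> ?B" "p \<notin> A"
        using less.prems(2,3) free by (cases p; force simp: free_def)+
      \<comment> \<open>After a step up no source is left in the row of \<open>p\<close>, so the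
        \<open>1\<close> of this row cannot be reached.\<close>
      moreover have "total (insert (up p) A) ?B = 0"
        using up_props(2)[OF free] less.prems(2)
        by (intro total_eq_0_sink[of fst "(fst p, \<pi> (fst p))"] step_fst) auto
      ultimately have "total (insert p A) ?B = wt p * total (insert (left p) A) ?B"
        using free less.prems(2) assms(2) by (subst step_total) auto
      also have "total (insert (left p) A) ?B = row_prod (left p) * total A B"
        using less.hyps[of "left p"] left_props(1,2)[OF free] less.prems by simp
      finally show ?thesis
        by (simp add: row_prod_free[OF free] mult.assoc)
    qed
  qed
qed

end

subsection \<open>Harmonic functions on the entries\<close>

lemma unit_inv_mult: "y dvd 1 \<Longrightarrow> y * unit_inv y = 1"
  by (metis dvd_def unit_inv_eq)

context permuted_array
begin

lemma row_prod_unit: "row_prod p dvd 1"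
proof -
  have "row_prod p dvd (\<Prod>l\<in>{l. l \<le> snd p \<and> (fst p, l) \<in> ent}. 1)"
    unfolding row_prod_def using wt_unit by (intro prod_dvd_prod) (metis dvd_def mem_Collect_eq)
  then show ?thesis by simp
qed

text \<open>
  \<open>lower b j\<close> indexes the elements of \<open>D\<close> other than \<open>1\<^sub>b\<close>, and \<open>walks b K y\<close> lets one further
  source \<open>y\<close>, not necessarily at the end of its row, take the place of the origin in the bottom row.
\<close>

definition lower :: "nat \<Rightarrow> nat \<Rightarrow> nat set" where
  "lower b j = {t. pinv \<pi> b < t \<and> t \<le> j \<and> b < \<pi> t}"

definition walks :: "nat \<Rightarrow> nat set \<Rightarrow> nat \<times> nat \<Rightarrow> laurent" where
  "walks b K y = total (insert y (rend ` K)) (insert (pinv \<pi> b, b) ((\<lambda>t. (t, \<pi> t)) ` K))"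

definition rhos :: "nat \<Rightarrow> nat \<Rightarrow> laurent" where
  "rhos b j = (\<Prod>t\<in>insert (pinv \<pi> b) (lower b j). row_prod (rend t))"

text \<open>This is the harmonic function \<open>h\<^sub>b\<close>: the formula for \<open>R\<close>
  with the bottom origin moved to an arbitrary entry \<open>p\<close>. The cut-off concerns entries
  left of or above \<open>1_b\<close>, from which no destination is reachable.\<close>

definition R_val :: "nat \<Rightarrow> nat \<times> nat \<Rightarrow> laurent" where
  "R_val b p = (if snd p < b \<or> fst p < pinv \<pi> b then 0
     else (-1) ^ card (lower b (fst p)) * walks b (lower b (fst p)) p * unit_inv (rhos b (fst p)))"

definition harmonic :: "(nat \<times> nat \<Rightarrow> laurent) \<Rightarrow> bool" where
  "harmonic \<phi> \<longleftrightarrow> (\<forall>p. free p \<longrightarrow> \<phi> p = wt p * (\<phi> (left p) +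
     (if vert \<or> snd p \<noteq> r then (-1) ^ (fst p - Suc (fst (up p))) * \<phi> (up p) else 0)))"

lemma finite_lower [simp]: "finite (lower b j)"
  by (simp add: lower_def)

lemma inj_rend: "inj_on rend K"
  by (metis fst_rend inj_onI)

lemma rhos_unit: "rhos b j * unit_inv (rhos b j) = 1"
proof -
  have "rhos b j dvd (\<Prod>t\<in>insert (pinv \<pi> b) (lower b j). 1)"
    unfolding rhos_def using row_prod_unit by (intro prod_dvd_prod) blast
  then show ?thesis by (intro unit_inv_mult) simp
qed

lemma rend_lower_in: "j \<le> r \<Longrightarrow> rend ` lower b j \<subseteq> ent"
  by (auto simp: lower_def intro!: rend_in)

text \<open>The rows \<open>t > i\<close> lie below \<open>y\<close>, \<open>1_b\<close> and all
  remaining destinations. From the bottom upwards, each of their sources goes straight left by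
  \<open>total_straight\<close> and splits off the factor \<open>row_prod (rend t)\<close>.\<close>

lemma walks_skip:
  assumes "i \<le> j" and "j \<le> r" and "y \<in> ent" and "fst y \<le> i" and "pinv \<pi> b \<le> i"
  shows "walks b (lower b j) y =
    (\<Prod>t\<in>lower b j - lower b i. row_prod (rend t)) * walks b (lower b i) y"
  using assms(1,2)
proof (induction j rule: dec_induct)
  case (step j)
  show ?case
  proof (cases "b < \<pi> (Suc j)")
    case True
    then have ins: "lower b (Suc j) = insert (Suc j) (lower b j)"
      using assms(5) step by (auto simp: lower_def le_Suc_eq)
    have nin: "Suc j \<notin> lower b j" by (simp add: lower_def)
    have "walks b (lower b (Suc j)) y = total (insert (rend (Suc j)) (insert y (rend ` lower b j)))
        (insert (Suc j, \<pi> (Suc j)) (insert (pinv \<pi> b, b) ((\<lambda>t. (t, \<pi> t)) ` lower b j)))"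
      by (simp add: walks_def ins insert_commute)
    also have "\<dots> = row_prod (rend (Suc j)) * walks b (lower b j) y"
    proof -
      have "total (insert (rend (Suc j)) (insert y (rend ` lower b j)))
          (insert (fst (rend (Suc j)), \<pi> (fst (rend (Suc j)))) (insert (pinv \<pi> b, b) ((\<lambda>t. (t, \<pi> t)) ` lower b j))) =
        row_prod (rend (Suc j)) * walks b (lower b j) y"
        unfolding walks_def
        using rend_in[of "Suc j"] rend_lower_in[of j b] step assms(3-5)
        by (intro total_straight) (auto simp: lower_def less_Suc_eq_le)
      then show ?thesis by simp
    qed
    moreover have "lower b (Suc j) - lower b i = insert (Suc j) (lower b j - lower b i)"
      using step by (auto simp: ins) (auto simp: lower_def)
    ultimately show ?thesis
      using step nin by (simp add: mult.assoc)
  next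
    case False
    then have "lower b (Suc j) = lower b j"
      by (auto simp: lower_def le_Suc_eq)
    then show ?thesis using step by simp
  qed
qed simp

text \<open>Every row skipped between \<open>up p\<close> and \<open>p\<close> belongs to
  \<open>lower b (fst p - 1)\<close>. It contributes one sign through the cardinality, and one
  factor of \<open>walks\<close> that cancels against \<open>rhos\<close>. This is the origin of the
  sign in \<open>harmonic\<close>.\<close>

lemma walks_up:
  assumes "free p" and "b \<le> snd p" and "pinv \<pi> b < fst p"
  shows "(-1) ^ (fst p - Suc (fst (up p))) * R_val b (up p) =
    (-1) ^ card (lower b (fst p - 1)) * walks b (lower b (fst p - 1)) (up p) *
      unit_inv (rhos b (fst p - 1))"
proof -
  define i where "i = fst (up p)"
  define j where "j = fst p - 1"
  have ij: "i \<le> j" "fst p = Suc j" "j \<le> r"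
    using up_props(2)[OF assms(1)] assms(1) by (cases p; auto simp: i_def j_def free_def entries_iff)+
  show ?thesis
  proof (cases "i < pinv \<pi> b")
    case True
    have "walks b (lower b j) (up p) = 0"
      unfolding walks_def using True
      by (intro total_eq_0_source[of fst "up p"] step_fst) (auto simp: i_def lower_def)
    then show ?thesis
      using True by (simp add: R_val_def i_def j_def)
  next
    case False
    \<comment> \<open>If the \<open>1\<close> of row \<open>t\<close> were weakly left of column
      \<open>snd p\<close>, then \<open>(t, snd p)\<close> would be a nonzero entry strictly between
      \<open>up p\<close> and \<open>p\<close>.\<close>
    have skipped: "snd p < \<pi> t" if "i < t" "t \<le> j" for t
    proof (rule ccontr)
      assume "\<not> snd p < \<pi> t"
      then have "(t, snd p) \<in> ent"
        using that ij up_props(3)[OF assms(1)] assms(1) by (cases p) (auto simp: entries_iff i_def free_def)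
      then show False
        using up_props(4)[OF assms(1), of t] that ij by (simp add: i_def)
    qed
    have D: "lower b j - lower b i = {i<..j}"
      using False skipped assms(2) by (force simp: lower_def)
    have sub: "lower b i \<subseteq> lower b j"
      using ij by (auto simp: lower_def)
    have "rhos b j = (\<Prod>t\<in>insert (pinv \<pi> b) (lower b i) \<union> {i<..j}. row_prod (rend t))"
      unfolding rhos_def using sub D by (intro prod.cong) auto
    also have "\<dots> = rhos b i * (\<Prod>t\<in>{i<..j}. row_prod (rend t))"
      unfolding rhos_def using False by (subst prod.union_disjoint) (auto simp: lower_def)
    finally have "rhos b i * ((\<Prod>t\<in>{i<..j}. row_prod (rend t)) * unit_inv (rhos b j)) = 1"
      using rhos_unit[of b j] by (simp add: mult.assoc)
    then have inv: "unit_inv (rhos b i) = (\<Prod>t\<in>{i<..j}. row_prod (rend t)) * unit_inv (rhos b j)"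
      by (rule unit_inv_eq)
    have "card (lower b j) = card (lower b i) + (j - i)"
      using card_Diff_subset[OF finite_lower sub] card_mono[OF finite_lower sub] by (simp add: D)
    moreover have "walks b (lower b j) (up p) =
        (\<Prod>t\<in>{i<..j}. row_prod (rend t)) * walks b (lower b i) (up p)"
      using walks_skip[of i j "up p" b] ij False up_props(1)[OF assms(1)] D by (simp add: i_def)
    ultimately show ?thesis
      using False assms(2) ij(2) by (simp add: R_val_def inv power_add mult_ac flip: i_def j_def)
  qed
qed

text \<open>
  Two sources in one row: the left one is confined to the row, and the right one has to leave the
  row before it reaches the left one. Moving the left source one step is then a local change.
\<close>

lemma total_two_in_row:
  assumes "free p" and "A \<subseteq> ent" and "finite B" and "Suc (card A) = card B"
    and A: "\<And>a. a \<in> A \<Longrightarrow> fst a < fst p" and B: "\<And>b. b \<in> B \<Longrightarrow> fst b < fst p"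
    and "y \<in> ent" and "fst y = fst p" and "snd p \<le> snd y"
  defines "B' \<equiv> insert (fst p, \<pi> (fst p)) B"
  shows "wt p * total (insert y (insert (left p) A)) B' = total (insert y (insert p A)) B' +
    (\<Prod>l\<in>{l. snd p < l \<and> l \<le> snd y \<and> (fst p, l) \<in> ent}. wt (fst p, l)) * row_prod p * wt p *
    (if vert \<or> snd p \<noteq> r then total (insert (up p) A) B else 0)"
  using assms(7-9)
proof (induction "snd y" arbitrary: y rule: less_induct)
  case less
  have finA: "finite A" using assms(2) finite_entries finite_subset by blast
  have cB: "card B' = Suc (card B)"
    unfolding B'_def using B[of "(fst p, \<pi> (fst p))"] \<open>finite B\<close> by (subst card_insert_disjoint) auto
  have notB: "q \<notin> B'" if "fst q = fst p" "\<pi> (fst p) < snd q" for q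
    using that B[of q] by (cases q) (auto simp: B'_def)
  have notA: "q \<notin> A" if "fst q = fst p" for q
    using that A[of q] by auto
  \<comment> \<open>If \<open>q\<close> steps up, \<open>z\<close> is the only source left in the
    row and must go straight to the \<open>1\<close>; this gives the factor
    \<open>row_prod z\<close>.\<close>
  have peel: "total (insert q (insert z A)) B' = wt q * (total (insert (left q) (insert z A)) B' +
      (if vert \<or> snd q \<noteq> r then row_prod z * total (insert (up q) A) B else 0))"
    if "free q" "fst q = fst p" "z \<in> ent" "fst z = fst p" "snd z < snd q" for q z
  proof -
    have "total (insert q (insert z A)) B' = wt q * (total (insert (left q) (insert z A)) B' +
      (if vert \<or> snd q \<noteq> r then total (insert (up q) (insert z A)) B' else 0))"
      using that finA assms(2,4) notA[of z] notA[of q] cB notB[of q] A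
      by (intro step_total) (auto simp: free_def)
    also have "total (insert (up q) (insert z A)) B' = row_prod z * total (insert (up q) A) B"
    proof -
      have "total (insert z (insert (up q) A)) (insert (fst z, \<pi> (fst z)) B) =
          row_prod z * total (insert (up q) A) B"
        using that up_props(1,2)[OF that(1)] assms(2) A B \<open>finite B\<close>
        by (intro total_straight) fastforce+
      then show ?thesis using that by (simp add: B'_def insert_commute)
    qed
    finally show ?thesis .
  qed
  have leftp: "left p \<in> ent" "snd (left p) < snd p"
    using left_props[OF assms(1)] by auto
  show ?case
  proof (cases "y = p")
    \<comment> \<open>Base case: on the left two sources coincide after a left step of
      \<open>p\<close>, on the right they coincide from the start. These totals vanish by
      cardinality, leaving only the step up from \<open>p\<close>.\<close>
    case True
    have "total (insert p A) B' = 0"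
      using finA cB assms(4) notA[of p] by (intro total_card_neq) simp
    moreover have "total (insert (left p) A) B' = 0"
      using finA cB assms(4) notA[of "left p"] by (intro total_card_neq) simp
    ultimately have "total (insert p (insert (left p) A)) B' = wt p * (row_prod (left p) *
        (if vert \<or> snd p \<noteq> r then total (insert (up p) A) B else 0))" "total (insert p (insert p A)) B' = 0"
      using peel[of p "left p"] assms(1) leftp by simp_all
    moreover have "{l. snd p < l \<and> l \<le> snd p \<and> (fst p, l) \<in> ent} = {}" by auto
    ultimately show ?thesis
      unfolding True row_prod_free[OF assms(1)] by (simp only: prod.empty mult_ac) simp
  next
    case False
    then have lt: "snd p < snd y"
      using less.prems by (simp add: prod_eq_iff)
    then have free: "free y"
      using less.prems assms(1) by (auto simp: free_def)
    have "p \<in> ent" using assms(1) by (simp add: free_def)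
    then have "snd p \<le> snd (left y)"
      using left_props(4)[OF free, of "snd p"] less.prems(2) lt by simp
    then have IH: "wt p * total (insert (left y) (insert (left p) A)) B' =
        total (insert (left y) (insert p A)) B' +
        (\<Prod>l\<in>{l. snd p < l \<and> l \<le> snd (left y) \<and> (fst p, l) \<in> ent}. wt (fst p, l)) * row_prod p * wt p *
        (if vert \<or> snd p \<noteq> r then total (insert (up p) A) B else 0)"
      using less.hyps[of "left y"] left_props(1,2)[OF free] less.prems by simp
    have "{l. snd p < l \<and> l \<le> snd y \<and> (fst p, l) \<in> ent} =
        insert (snd y) {l. snd p < l \<and> l \<le> snd (left y) \<and> (fst p, l) \<in> ent}"
    proof -
      have "(fst p, snd y) \<in> ent"
        using less.prems(1,2) by (metis prod.collapse)
      moreover have "l \<le> snd (left y) \<or> l = snd y" if "(fst p, l) \<in> ent" "l \<le> snd y" for l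
        using left_props(4)[OF free, of l] less.prems(2) that by force
      ultimately show ?thesis
        using left_props(2)[OF free] lt by auto
    qed
    moreover have "wt (fst p, snd y) = wt y"
      using less.prems(2) by (simp flip: less.prems(2))
    moreover have "snd y \<notin> {l. snd p < l \<and> l \<le> snd (left y) \<and> (fst p, l) \<in> ent}"
      using left_props(2)[OF free] by simp
    moreover have "finite {l. snd p < l \<and> l \<le> snd (left y) \<and> (fst p, l) \<in> ent}"
      using finite_row(2)[of "\<lambda>l. snd p < l \<and> l \<le> snd (left y)"] by (simp add: conj_assoc)
    ultimately have prod: "(\<Prod>l\<in>{l. snd p < l \<and> l \<le> snd y \<and> (fst p, l) \<in> ent}. wt (fst p, l)) =
        wt y * (\<Prod>l\<in>{l. snd p < l \<and> l \<le> snd (left y) \<and> (fst p, l) \<in> ent}. wt (fst p, l))"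
      by simp
    let ?u = "if vert \<or> snd y \<noteq> r then total (insert (up y) A) B else 0"
    have 1: "total (insert y (insert p A)) B' =
        wt y * (total (insert (left y) (insert p A)) B' + row_prod p * ?u)"
      using peel[of y p] free less.prems \<open>p \<in> ent\<close> lt by simp
    have 2: "total (insert y (insert (left p) A)) B' =
        wt y * (total (insert (left y) (insert (left p) A)) B' + row_prod (left p) * ?u)"
      using peel[of y "left p"] free less.prems leftp lt by simp
    \<comment> \<open>The vertical terms at \<open>y\<close> agree on both sides since
      \<open>wt p * row_prod (left p) = row_prod p\<close>; the rest is the induction hypothesis
      multiplied by \<open>wt y\<close>.\<close>
    show ?thesis
      unfolding 1 2 prod using arg_cong[OF IH, of "(*) (wt y)"]
      by (simp only: row_prod_free[OF assms(1)] distrib_left mult_ac add_ac)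
  qed
qed

text \<open>Left of or above \<open>1_b\<close> everything is 0, and in the row of
  \<open>1_b\<close> the value is a multiple of \<open>row_prod\<close>. Below that row the relation
  comes from peeling off \<open>p\<close> or, if the row of \<open>p\<close> carries an origin of
  its own (\<open>b < \<pi> j\<close>), from comparing two sources in one row.\<close>

lemma harmonic_R_val:
  assumes "1 \<le> b" and "b \<le> r"
  shows "harmonic (R_val b)"
  unfolding harmonic_def
proof (intro allI impI)
  fix p assume free: "free p"
  define j where "j = fst p"
  let ?v = "\<lambda>x. if vert \<or> snd p \<noteq> r then x else (0::laurent)"
  have p: "p \<in> ent" "\<pi> j < snd p" "j \<le> r" "1 \<le> j"
    using free by (cases p; auto simp: free_def j_def entries_iff)+
  have left: "left p \<in> ent" "snd (left p) < snd p" "\<pi> j \<le> snd (left p)"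
    using left_props[OF free] by (auto simp: j_def)
  have up: "up p \<in> ent" "fst (up p) < j"
    using up_props[OF free] by (auto simp: j_def)
  consider "snd p < b \<or> j < pinv \<pi> b" | "b \<le> snd p" "j = pinv \<pi> b" | "b \<le> snd p" "pinv \<pi> b < j"
    by linarith
  then show "R_val b p = wt p * (R_val b (left p) + ?v ((-1) ^ (fst p - Suc (fst (up p))) * R_val b (up p)))"
  proof cases
    case 1
    then show ?thesis
      using left up by (auto simp: R_val_def j_def)
  next
    case 2
    have K: "lower b j = {}" using 2 by (auto simp: lower_def)
    have walks: "walks b {} q = row_prod q" if "q \<in> ent" "fst q = j" for q
      using total_straight[of q "{}" "{}"] that 2 by (simp add: walks_def total_empty)
    have "R_val b (up p) = 0"
      using up 2 by (simp add: R_val_def)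
    moreover have "b \<le> snd (left p)"
      using left(3) 2 by simp
    moreover have "R_val b q = row_prod q * unit_inv (rhos b j)" if "q \<in> ent" "fst q = j" "b \<le> snd q" for q
      using that walks[of q] by (simp add: R_val_def K 2(2)[symmetric])
    ultimately show ?thesis
      using 2 left p by (simp add: row_prod_free[OF free] mult.assoc j_def)
  next
    case 3
    let ?K = "lower b (j - 1)" and ?one = "\<lambda>t. (t, \<pi> t)"
    have U: "(-1) ^ (fst p - Suc (fst (up p))) * R_val b (up p) =
        (-1) ^ card ?K * walks b ?K (up p) * unit_inv (rhos b (j - 1))"
      using walks_up[OF free] 3 by (simp add: j_def)
    have card_one: "card (insert (pinv \<pi> b, b) (?one ` ?K)) = Suc (card (rend ` ?K))"
    proof -
      have "inj_on ?one ?K" by (auto intro: inj_onI)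
      moreover have "(pinv \<pi> b, b) \<notin> ?one ` ?K" by (auto simp: lower_def)
      ultimately show ?thesis by (simp add: card_image inj_rend)
    qed
    have rend_less: "fst q < j" if "q \<in> rend ` ?K" for q
      using that 3(2) by (auto simp: lower_def)
    have one_less: "fst q < j" if "q \<in> insert (pinv \<pi> b, b) (?one ` ?K)" for q
      using that 3(2) by (auto simp: lower_def)
    have sub: "rend ` ?K \<subseteq> ent"
      using p(3) by (intro rend_lower_in) simp
    have le_j: "t \<le> j \<longleftrightarrow> t \<le> j - 1 \<or> t = j" for t
      using p(4) by auto
    have "\<pi> j \<noteq> b" using 3 by auto
    then consider "\<pi> j < b" | "b < \<pi> j" by linarith
    then show ?thesis
    proof cases
      case 1
      then have K: "lower b j = ?K"
        using le_j by (auto simp: lower_def)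
      have "p \<notin> rend ` ?K" "p \<notin> insert (pinv \<pi> b, b) (?one ` ?K)"
        using rend_less[of p] one_less[of p] by (auto simp: j_def)
      then have "walks b ?K p = wt p * (walks b ?K (left p) + ?v (walks b ?K (up p)))"
        unfolding walks_def using rend_less one_less sub card_one free
        by (intro step_total) (auto simp flip: j_def)
      moreover have "walks b ?K (left p) = 0" if "snd (left p) < b"
        unfolding walks_def using that
        by (intro total_eq_0_source[of snd "left p"] step_snd) (auto simp: lower_def)
      moreover have "rhos b j = rhos b (j - 1)"
        by (simp add: rhos_def K)
      ultimately show ?thesis
        unfolding U using 3 K left
        by (auto simp: R_val_def distrib_left distrib_right mult_ac simp flip: j_def)
    next
      case 2
      have K: "lower b j = insert j ?K"
        using 3(2) 2 le_j by (auto simp: lower_def)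
      have j: "j \<notin> ?K" using p(4) by (auto simp: lower_def)
      define Q where "Q q = walks b (insert j ?K) q" for q
      have Q: "Q q = total (insert (rend j) (insert q (rend ` ?K)))
          (insert (fst p, \<pi> (fst p)) (insert (pinv \<pi> b, b) (?one ` ?K)))" for q
        by (simp add: Q_def walks_def insert_commute flip: j_def)
      have rendj: "rend j \<in> ent" "snd p \<le> snd (rend j)"
        using p rend_in[of j] rend_ge[of j "snd p"] by (auto simp: j_def)
      have "wt p * Q (left p) = Q p +
          (\<Prod>l\<in>{l. snd p < l \<and> l \<le> snd (rend j) \<and> (fst p, l) \<in> ent}. wt (fst p, l)) * row_prod p * wt p *
          ?v (walks b ?K (up p))"
        unfolding Q walks_def[of b ?K] using free rend_less one_less sub card_one rendj
        by (intro total_two_in_row) (auto simp: j_def)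
      also have "(\<Prod>l\<in>{l. snd p < l \<and> l \<le> snd (rend j) \<and> (fst p, l) \<in> ent}. wt (fst p, l)) * row_prod p =
          row_prod (rend j)"
        unfolding row_prod_def fst_rend j_def[symmetric]
        using rendj(2) finite_row(1)[of j]
        by (subst prod.union_disjoint[symmetric]) (auto intro!: prod.cong elim: finite_subset[rotated])
      finally have two: "wt p * Q (left p) = Q p + row_prod (rend j) * wt p * ?v (walks b ?K (up p))" .
      have "rhos b j = row_prod (rend j) * rhos b (j - 1)"
        using j 3 by (simp add: rhos_def K insert_commute)
      then have "rhos b (j - 1) * (row_prod (rend j) * unit_inv (rhos b j)) = 1"
        using rhos_unit[of b j] by (simp add: mult_ac)
      then have inv: "unit_inv (rhos b (j - 1)) = row_prod (rend j) * unit_inv (rhos b j)"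
        by (rule unit_inv_eq)
      define s where "s = (-1 :: laurent) ^ card ?K * unit_inv (rhos b j)"
      \<comment> \<open>Adding \<open>j\<close> to \<open>lower\<close> adds one factor -1, while
        \<open>up p\<close> is evaluated with the smaller index set; this change of sign turns
        \<open>two\<close> into harmonicity.\<close>
      have R: "R_val b q = - (s * Q q)" if "fst q = j" "b \<le> snd q" for q
        using that 3 j by (simp add: R_val_def K s_def Q_def)
      have "R_val b p = - (s * Q p)" "R_val b (left p) = - (s * Q (left p))"
        using left 2 3 by (auto intro!: R simp: j_def)
      moreover have "(-1) ^ card ?K * walks b ?K (up p) * unit_inv (rhos b (j - 1)) =
          s * row_prod (rend j) * walks b ?K (up p)"
        unfolding s_def inv by (simp only: mult_ac)
      ultimately show ?thesis
        unfolding U using arg_cong[OF two, of "(*) s"] by (auto simp: algebra_simps)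
    qed
  qed
qed

end

section \<open>Values of \<open>R_val\<close> at the \<open>1\<close>-entries and at the ends of the
  rows\<close>

context permuted_array
begin

lemma R_val_one:
  assumes "c < b"
  shows "R_val b (pinv \<pi> c, c) = 0"
  using assms by (simp add: R_val_def)

text \<open>Here \<open>lower\<close> is empty, so the only system is the trivial path and only the
  denominator \<open>\<rho>(1_b)\<close> survives. The value does not depend on
  \<open>vert\<close>.\<close>

lemma R_val_one_self:
  assumes "1 \<le> b" and "b \<le> r"
  shows "R_val b (pinv \<pi> b, b) = unit_inv (row_prod (rend (pinv \<pi> b)))"
proof -
  have "lower b (pinv \<pi> b) = {}" by (auto simp: lower_def)
  moreover have "row_prod (pinv \<pi> b, b) = 1" "(pinv \<pi> b, b) \<in> ent"
    using row_prod_one[of "pinv \<pi> b"] one_in_entries[of "pinv \<pi> b"] assms by simp_all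
  ultimately show ?thesis
    using total_straight[of "(pinv \<pi> b, b)" "{}" "{}"]
    by (simp add: R_val_def walks_def rhos_def total_empty)
qed

lemma R_val_rend_same:
  assumes "1 \<le> b" and "b \<le> r"
  shows "R_val b (rend (pinv \<pi> b)) = 1"
proof -
  have "rend (pinv \<pi> b) \<in> ent" "(pinv \<pi> b, b) \<in> ent"
    using rend_in[of "pinv \<pi> b"] one_in_entries[of "pinv \<pi> b"] assms by simp_all
  moreover have "lower b (pinv \<pi> b) = {}" by (auto simp: lower_def)
  ultimately show ?thesis
    using total_straight[of "rend (pinv \<pi> b)" "{}" "{}"] rend_ge[of "pinv \<pi> b" b]
      unit_inv_mult[OF row_prod_unit]
    by (simp add: R_val_def walks_def rhos_def total_empty)
qed

text \<open>The \<open>1\<close> of row \<open>k\<close> lies right of column \<open>b\<close>. If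
  it is also below \<open>1_b\<close>, the end of row \<open>k\<close> is already an origin; the
  added source coincides with it, and the cardinalities disagree.\<close>

lemma R_val_rend_0:
  assumes "b < \<pi> k"
  shows "R_val b (rend k) = 0"
proof (cases "k < pinv \<pi> b")
  case False
  have "pinv \<pi> b \<noteq> k" using assms by auto
  then have k: "k \<in> lower b k"
    using False assms by (simp add: lower_def)
  have "card (insert (pinv \<pi> b, b) ((\<lambda>t. (t, \<pi> t)) ` lower b k)) = Suc (card (lower b k))"
    by (subst card_insert_disjoint) (auto simp: lower_def card_image inj_on_def)
  moreover have "card (insert (rend k) (rend ` lower b k)) = card (lower b k)"
    using k by (simp add: insert_absorb card_image inj_rend)
  ultimately show ?thesis
    by (simp add: R_val_def walks_def total_card_neq)
qed (simp add: R_val_def)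

lemma D_set_eq:
  assumes "1 \<le> b" and "b \<le> r" and "\<pi> k < b" and "pinv \<pi> b < k" and "k \<le> r"
  shows "D_set r \<pi> (\<pi> k) b = (\<lambda>t. (t, \<pi> t)) ` insert (pinv \<pi> b) (lower b k)"
proof (intro equalityI subsetI)
  fix q assume "q \<in> D_set r \<pi> (\<pi> k) b"
  then obtain c where c: "q = (pinv \<pi> c, c)" "pinv \<pi> b \<le> pinv \<pi> c" "pinv \<pi> c \<le> k" "b \<le> c"
    by (auto simp: D_set_def one_pos_def M_pos_def)
  have "pinv \<pi> c = pinv \<pi> b \<or> pinv \<pi> c \<in> lower b k"
  proof (cases "c = b")
    case False
    then have "pinv \<pi> c \<noteq> pinv \<pi> b" by (metis pinv_simps(2))
    then show ?thesis using c False by (simp add: lower_def)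
  qed simp
  then show "q \<in> (\<lambda>t. (t, \<pi> t)) ` insert (pinv \<pi> b) (lower b k)"
    by (intro image_eqI[of _ _ "pinv \<pi> c"]) (use c in auto)
next
  fix q assume "q \<in> (\<lambda>t. (t, \<pi> t)) ` insert (pinv \<pi> b) (lower b k)"
  then obtain t where t: "q = (t, \<pi> t)" "t = pinv \<pi> b \<or> t \<in> lower b k" by blast
  then have "pinv \<pi> b \<le> t" "t \<le> k" "b \<le> \<pi> t" "1 \<le> t" "t \<le> r"
    using assms by (auto simp: lower_def)
  moreover from this have "one_pos \<pi> (\<pi> t) \<in> one_pos \<pi> ` {1..r}" by (intro imageI) simp
  moreover have "one_pos \<pi> (\<pi> t) = (t, \<pi> t)" by (simp add: one_pos_def)
  ultimately show "q \<in> D_set r \<pi> (\<pi> k) b"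
    using t(1) by (simp add: D_set_def M_pos_def)
qed

text \<open>Each row involved has an entry weakly right of column \<open>b\<close>: its
  \<open>1\<close>, or the entry \<open>(k, b)\<close>. Cutting down to \<open>M_pos\<close>
  therefore keeps the right end of the row.\<close>

lemma O_set_eq:
  assumes "1 \<le> b" and "b \<le> r" and "\<pi> k < b" and "pinv \<pi> b < k" and "k \<le> r"
  shows "O_set r \<pi> (\<pi> k) b = insert (rend k) (rend ` lower b k)"
proof -
  have "rightmost_in_M r \<pi> (\<pi> k) b t = rend t"
    if "t \<in> insert k (lower b k)" for t
  proof -
    have t: "1 \<le> t" "t \<le> r" "pinv \<pi> b \<le> t" "t \<le> k" "(t, b) \<in> ent \<or> b \<le> \<pi> t"
      using that assms by (auto simp: lower_def entries_iff)
    then obtain l where l: "(t, l) \<in> ent" "b \<le> l"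
      using one_in_entries[of t] by auto
    have "Max {l. (t, l) \<in> ent \<inter> M_pos r \<pi> (\<pi> k) b} = Max {l. (t, l) \<in> ent}"
    proof (rule Max_eqI)
      have "rend t \<in> ent" by (rule rend_in) (use t in auto)
      moreover have "b \<le> snd (rend t)"
        using l rend_ge[of t l] by simp
      ultimately show "Max {l. (t, l) \<in> ent} \<in> {l. (t, l) \<in> ent \<inter> M_pos r \<pi> (\<pi> k) b}"
        using t by (auto simp: rend_def M_pos_def entries_iff)
    next
      show "finite {l. (t, l) \<in> ent \<inter> M_pos r \<pi> (\<pi> k) b}"
        by (rule finite_subset[OF _ finite_row(1)[of t]]) blast
      show "l \<le> Max {l. (t, l) \<in> ent}" if "l \<in> {l. (t, l) \<in> ent \<inter> M_pos r \<pi> (\<pi> k) b}" for l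
        using that by (intro Max_ge[OF finite_row(1)]) blast
    qed
    then show ?thesis by (simp add: rightmost_in_M_def rend_def)
  qed
  then have "rightmost_in_M r \<pi> (\<pi> k) b ` insert k (lower b k) = rend ` insert k (lower b k)"
    by (rule image_cong[OF refl])
  moreover have "fst ` (D_set r \<pi> (\<pi> k) b - {one_pos \<pi> b}) = lower b k"
  proof -
    have "D_set r \<pi> (\<pi> k) b - {one_pos \<pi> b} = (\<lambda>t. (t, \<pi> t)) ` lower b k"
      unfolding D_set_eq[OF assms] by (auto simp: one_pos_def lower_def)
    then show ?thesis by (simp add: image_image)
  qed
  ultimately show ?thesis
    by (simp add: O_set_def)
qed

lemma R_val_rend:
  assumes "1 \<le> b" and "b \<le> r" and "\<pi> k < b" and "pinv \<pi> b < k" and "k \<le> r"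
  shows "R_val b (rend k) = (-1) ^ (card (D_set r \<pi> (\<pi> k) b) - 1) *
    total (O_set r \<pi> (\<pi> k) b) (D_set r \<pi> (\<pi> k) b) * unit_inv (\<Prod>p\<in>D_set r \<pi> (\<pi> k) b. rho r \<pi> p)"
proof -
  have "inj_on (\<lambda>t. (t, \<pi> t)) K" for K by (auto intro: inj_onI)
  then have "card (D_set r \<pi> (\<pi> k) b) = Suc (card (lower b k))"
    "(\<Prod>p\<in>D_set r \<pi> (\<pi> k) b. rho r \<pi> p) = rhos b k"
    unfolding D_set_eq[OF assms] rhos_def
    by (simp_all only: card_image prod.reindex o_def rho_eq) (simp add: lower_def)
  moreover have "(k, b) \<in> ent"
    using assms by (simp add: entries_iff)
  then have "b \<le> snd (rend k)" by (rule rend_ge)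
  ultimately show ?thesis
    using assms(4) by (simp add: R_val_def walks_def O_set_eq[OF assms] D_set_eq[OF assms])
qed

section \<open>Comparison of \<open>total\<close> with \<open>P_sum\<close> and
  \<open>PL_sum\<close>\<close>

lemma weight_eq:
  assumes "S \<subseteq> paths"
  shows "weight S = path_weight r \<pi> S"
  unfolding weight_def path_weight_def
proof (rule prod.cong[OF refl])
  fix ps assume "ps \<in> S"
  then have ps: "set ps \<subseteq> ent" using assms by (auto simp: paths_def)
  have "wt p = 1" if "p \<in> set ps - set ps \<inter> free_pos r \<pi>" for p
    using ps that by (cases p) (auto simp: wt_def wn_def n_entry_def free_pos_def entries_def split: if_splits)
  then show "(\<Prod>p\<in>set ps. wt p) = (\<Prod>(k, l)\<in>set ps \<inter> free_pos r \<pi>. wn r \<pi> k l)"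
    by (intro prod.mono_neutral_cong_right) (auto simp: wt_def)
qed

lemma total_P:
  assumes vert
  shows "total A B = P_sum r \<pi> A B"
proof -
  have step: "step = (\<lambda>p q. neighbors r \<pi> p q \<and> (up_step p q \<or> left_step p q))"
    unfolding step_def using assms by blast
  have "ps \<in> paths \<longleftrightarrow> is_path r \<pi> ps" for ps
    unfolding paths_def is_path_def by (subst step) simp
  then have "S \<subseteq> paths \<longleftrightarrow> (\<forall>ps\<in>S. is_path r \<pi> ps)" for S
    unfolding subset_iff by (simp only: Ball_def)
  then have "systems A B = path_systems r \<pi> A B"
    unfolding systems_def path_systems_def by (simp only:)
  then show ?thesis
    unfolding total_def P_sum_def
    by (intro sum.cong) (auto simp: systems_def intro!: weight_eq)
qed

text \<open>A path that leaves the last column never returns to it. Hence forbidding vertical steps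
  in that column amounts to requiring that the first step go left whenever the origin lies
  there.\<close>

lemma total_PL:
  assumes "\<not> vert"
  shows "total A B = PL_sum r \<pi> A B"
proof -
  let ?E = "\<lambda>p q. neighbors r \<pi> p q \<and> (up_step p q \<or> left_step p q)"
  have step_D: "step p q \<Longrightarrow> ?E p q" "step p q \<Longrightarrow> snd p = r \<Longrightarrow> left_step p q"
    and step_I: "?E p q \<Longrightarrow> snd p < r \<or> snd q < r \<Longrightarrow> step p q" for p q
    unfolding step_def using assms by (auto simp only: up_step_def)
  have inner: "successively step ps" if "successively ?E ps" "ps \<noteq> []" "snd (hd ps) < r" for ps
    using that
  proof (induction ps)
    case (Cons p ps)
    show ?case
    proof (cases ps)
      case (Cons q qs)
      then have "?E p q" "snd p < r" using Cons.prems by auto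
      moreover from this have "snd q < r" by (auto simp: up_step_def left_step_def)
      ultimately show ?thesis
        using Cons Cons.prems Cons.IH step_I by simp
    qed simp
  qed simp
  have "ps \<in> paths \<longleftrightarrow>
      is_path r \<pi> ps \<and> (length ps \<ge> 2 \<and> snd (hd ps) = r \<longrightarrow> left_step (ps ! 0) (ps ! 1))" (is "?l \<longleftrightarrow> ?r") for ps
  proof
    assume l: ?l
    then have ps: "ps \<noteq> []" "set ps \<subseteq> ent" "successively step ps"
      by (simp_all add: paths_def)
    have "successively ?E ps"
      using ps(3) by (rule successively_mono) (rule step_D(1))
    then have "is_path r \<pi> ps"
      using ps by (simp add: is_path_def)
    moreover have "left_step (ps ! 0) (ps ! 1)" if long: "length ps \<ge> 2" "snd (hd ps) = r"
    proof -
      obtain p q qs where "ps = p # q # qs"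
        using long(1) by (cases ps; cases "tl ps") auto
      then show ?thesis
        using ps(3) long(2) step_D(2)[of p q] by simp
    qed
    ultimately show ?r by blast
  next
    assume r: ?r
    show ?l
    proof (cases "ps = [] \<or> tl ps = []")
      case True
      with r show ?thesis by (cases ps) (auto simp: paths_def is_path_def)
    next
      case False
      then obtain p q qs where ps: "ps = p # q # qs"
        by (cases ps; cases "tl ps") auto
      with r have pq: "?E p q" "successively ?E (q # qs)" "p \<in> ent" "set ps \<subseteq> ent"
        by (auto simp: is_path_def)
      have "snd p \<le> r" using pq(3) by (cases p) (simp add: entries_iff)
      then have "snd q < r"
        using r ps pq(1) by (auto simp: left_step_def up_step_def)
      then have "successively step ps"
        using inner[of "q # qs"] step_I[of p q] ps pq by simp
      then show ?thesis using pq ps by (simp add: paths_def)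
    qed
  qed
  then have "S \<subseteq> paths \<longleftrightarrow> (\<forall>ps\<in>S. is_path r \<pi> ps) \<and>
      (\<forall>ps\<in>S. length ps \<ge> 2 \<and> snd (hd ps) = r \<longrightarrow> left_step (ps ! 0) (ps ! 1))" for S
    unfolding subset_iff by (simp only: Ball_def all_conj_distrib imp_conjR)
  then have "systems A B = path_systems_L r \<pi> A B"
    unfolding systems_def path_systems_L_def path_systems_def
    by (simp only: mem_Collect_eq conj_ac)
  then show ?thesis
    unfolding total_def PL_sum_def
    by (intro sum.cong) (auto simp: systems_def intro!: weight_eq)
qed

lemma Inv_iff:
  "1 \<le> k \<Longrightarrow> k \<le> r \<Longrightarrow> 1 \<le> b \<Longrightarrow> b \<le> r \<Longrightarrow> (\<pi> k, b) \<in> Inv r \<pi> \<longleftrightarrow> \<pi> k < b \<and> pinv \<pi> b < k"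
  by (auto simp: Inv_def)

lemma R_val_rend_other:
  assumes "1 \<le> k" and "k \<le> r" and "1 \<le> b" and "b \<le> r" and "(\<pi> k, b) \<notin> Inv r \<pi>"
  shows "R_val b (rend k) = u_entry r \<pi> (\<pi> k) b"
proof -
  consider "\<pi> k = b" | "b < \<pi> k" | "\<pi> k < b" "k < pinv \<pi> b"
    using assms Inv_iff[of k b] by (metis linorder_cases pinv_simps(2))
  then show ?thesis
  proof cases
    case 1
    then have "k = pinv \<pi> b" by auto
    then show ?thesis
      using 1 R_val_rend_same[of b] assms by (simp add: u_entry_def n_entry_def)
  next
    case 2
    then show ?thesis
      using R_val_rend_0[of b k] assms by (simp add: u_entry_def n_entry_def)
  next
    case 3
    then show ?thesis
      using assms by (simp add: R_val_def u_entry_def n_entry_def)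
  qed
qed

lemma wu_eq_R_val:
  assumes "vert" and "1 \<le> k" and "k \<le> r" and "1 \<le> b" and "b \<le> r"
  shows "wu r \<pi> k b = R_val b (rend k)"
proof (cases "(\<pi> k, b) \<in> Inv r \<pi>")
  case True
  then show ?thesis
    using R_val_rend[of b k] Inv_iff[of k b] assms(2-)
    unfolding total_P[OF assms(1)] by (simp add: wu_def u_entry_def R_map_def)
next
  case False
  then show ?thesis
    using R_val_rend_other[of k b] assms(2-) by (simp add: wu_def u_entry_def)
qed

lemma xL_eq_R_val:
  assumes "\<not> vert" and "1 \<le> k" and "k \<le> r" and "1 \<le> b" and "b \<le> r"
  shows "xL r \<pi> k b = R_val b (rend k)"
proof (cases "(\<pi> k, b) \<in> Inv r \<pi>")
  case True
  then show ?thesis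
    using R_val_rend[of b k] Inv_iff[of k b] assms(2-)
    unfolding total_PL[OF assms(1)] by (simp add: xL_def RL_map_def)
next
  case False
  then show ?thesis
    using R_val_rend_other[of k b] assms(2-) by (simp add: xL_def u_entry_def)
qed

text \<open>The solution of the recursion in \<open>harmonic\<close> with boundary value 1 at
  \<open>1_c\<close> and 0 at the other sinks, computed along the rank.\<close>

function green :: "nat \<Rightarrow> nat \<times> nat \<Rightarrow> laurent" where
  "green c p = (if free p then wt p * (green c (left p) +
       (if vert \<or> snd p \<noteq> r then (-1) ^ (fst p - Suc (fst (up p))) * green c (up p) else 0))
     else if snd p = c then 1 else 0)"
  by pat_completeness auto
termination
proof (relation "measure (\<lambda>(c, p). rk p)")
  show "free p \<Longrightarrow> ((c, left p), (c, p)) \<in> measure (\<lambda>(c, p). rk p)" for c p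
    using left_props(2)[of p] by (auto intro: rk_less)
  show "free p \<Longrightarrow> ((c, up p), (c, p)) \<in> measure (\<lambda>(c, p). rk p)" for c p
    using up_props(1,2)[of p] by (auto intro: rk_less)
qed simp

declare green.simps [simp del]

lemma not_free:
  assumes "p \<in> ent" and "\<not> free p"
  shows "p = (pinv \<pi> (snd p), snd p)" and "snd p \<in> {1..r}"
proof -
  have "snd p = \<pi> (fst p)"
    using assms by (cases p) (simp add: free_def entries_iff)
  then show "p = (pinv \<pi> (snd p), snd p)"
    by (simp add: prod_eq_iff)
  show "snd p \<in> {1..r}"
    using assms by (cases p) (simp add: entries_iff)
qed

text \<open>Both sides satisfy the same linear recursion and agree at the sinks, so a harmonic
  function is a superposition of Green functions.\<close>

lemma harmonic_eq_green:
  assumes "harmonic \<phi>" and "p \<in> ent"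
  shows "\<phi> p = (\<Sum>c\<in>{1..r}. green c p * \<phi> (pinv \<pi> c, c))"
  using assms(2)
proof (induction "rk p" arbitrary: p rule: less_induct)
  case less
  show ?case
  proof (cases "free p")
    case True
    have "\<phi> (left p) = (\<Sum>c\<in>{1..r}. green c (left p) * \<phi> (pinv \<pi> c, c))"
      "\<phi> (up p) = (\<Sum>c\<in>{1..r}. green c (up p) * \<phi> (pinv \<pi> c, c))"
      using less.hyps[OF rk_less(1)[OF fst_left left_props(2)[OF True]] left_props(1)[OF True]]
        less.hyps[OF rk_less(2)[OF up_props(1,2)[OF True]] up_props(1)[OF True]]
      by simp_all
    moreover have green: "green c p = wt p * (green c (left p) +
        (if vert \<or> snd p \<noteq> r then 1 else 0) * ((-1) ^ (fst p - Suc (fst (up p))) * green c (up p)))" for c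
      using True by (subst green.simps) simp
    moreover have "\<phi> p = wt p * (\<phi> (left p) +
        (if vert \<or> snd p \<noteq> r then 1 else 0) * ((-1) ^ (fst p - Suc (fst (up p))) * \<phi> (up p)))"
      using assms(1)[unfolded harmonic_def, rule_format, OF True] by simp
    ultimately show ?thesis
      by (simp only: sum_distrib_left sum.distrib distrib_left distrib_right mult.assoc)
  next
    case False
    note p = not_free[OF less.prems False]
    have "(\<Sum>c\<in>{1..r}. green c p * \<phi> (pinv \<pi> c, c)) =
        (\<Sum>c\<in>{1..r}. if c = snd p then \<phi> (pinv \<pi> c, c) else 0)"
      using False by (intro sum.cong) (auto simp: green.simps[of _ p])
    then show ?thesis using p by simp
  qed
qed

text \<open>The entry \<open>1_r\<close> is alone in its row, so only vertical steps in the last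
  column lead to it, and these are absent.\<close>

lemma green_last:
  assumes "\<not> vert" and "p \<in> ent" and "p \<noteq> (pinv \<pi> r, r)"
  shows "green r p = 0"
  using assms(2,3)
proof (induction "rk p" arbitrary: p rule: less_induct)
  case less
  show ?case
  proof (cases "free p")
    case True
    have le: "snd p \<le> r" using less.prems by (cases p) (simp add: entries_iff)
    have "snd (left p) < r" using left_props(2)[OF True] le by simp
    then have "green r (left p) = 0"
      using left_props(1,2)[OF True] by (intro less.hyps rk_less) auto
    moreover have "green r (up p) = 0" if "snd p \<noteq> r"
      using up_props(1,2)[OF True] that snd_up[of p] by (intro less.hyps rk_less) (auto simp del: snd_up)
    moreover have "(if vert \<or> snd p \<noteq> r then x else 0) = (if snd p \<noteq> r then x else 0)" for x :: laurent
      using assms(1) by argo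
    ultimately show ?thesis
      using True by (subst green.simps) simp
  next
    case False
    have "p = (pinv \<pi> (snd p), snd p)"
      using not_free[OF less.prems(1) False] by simp
    then have "snd p \<noteq> r" using less.prems(2) by auto
    then show ?thesis
      using False by (subst green.simps) simp
  qed
qed

end

subsection \<open>Row operations on determinants\<close>

text \<open>Left multiplication by a unipotent lower bidiagonal matrix: all rows change at once,
  each by the original row above it. The assumption \<open>c 0 = 0\<close> answers truncated
  subtraction, by which row \<open>0 - 1\<close> is row \<open>0\<close>.\<close>

lemma det_bidiagonal_row_op:
  fixes f :: "nat \<Rightarrow> nat \<Rightarrow> 'a::comm_ring_1"
  assumes "c 0 = 0"
  shows "det (mat n n (\<lambda>(q, l). f q l - c q * f (q - 1) l)) = det (mat n n (\<lambda>(q, l). f q l))"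
proof -
  let ?L = "mat n n (\<lambda>(q, p). if p = q then 1 else if Suc p = q then - c q else 0)"
  have "mat n n (\<lambda>(q, l). f q l - c q * f (q - 1) l) = ?L * mat n n (\<lambda>(q, l). f q l)"
  proof (rule eq_matI; simp add: scalar_prod_def)
    fix q l assume ql: "q < n" "l < n"
    have "(\<Sum>p = 0..<n. (if p = q then 1 else if Suc p = q then - c q else 0) * f p l) =
        (\<Sum>p = 0..<n. (if p = q then f q l else 0) + (if Suc p = q then - c q * f p l else 0))"
      by (intro sum.cong) auto
    also have "\<dots> = f q l + (\<Sum>p = 0..<n. if Suc p = q then - c q * f p l else 0)"
      using ql by (simp add: sum.distrib)
    also have "(\<Sum>p = 0..<n. if Suc p = q then - c q * f p l else 0) = - c q * f (q - 1) l"
    proof (cases q)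
      case (Suc m)
      then show ?thesis using ql by simp
    qed (simp add: assms)
    finally show "f q l - c q * f (q - Suc 0) l =
        (\<Sum>p = 0..<n. (if p = q then 1 else if Suc p = q then - c q else 0) * f p l)"
      by simp
  qed
  moreover have "det ?L = 1"
    by (subst det_lower_triangular[of n]) (auto simp: prod_list_diag_prod)
  ultimately show ?thesis
    by (simp add: det_mult[of _ n])
qed

lemma det_single_entry_last_column:
  fixes f :: "nat \<Rightarrow> nat \<Rightarrow> 'a::comm_ring_1"
  assumes "q0 < n" and "\<And>q. q < n \<Longrightarrow> q \<noteq> q0 \<Longrightarrow> f q (n - 1) = 0"
  shows "det (mat n n (\<lambda>(q, l). f q l)) = (-1) ^ (q0 + n - 1) * f q0 (n - 1) *
    det (mat (n - 1) (n - 1) (\<lambda>(q, l). f (if q < q0 then q else Suc q) l))"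
proof -
  let ?A = "mat n n (\<lambda>(q, l). f q l)"
  have "det ?A = (\<Sum>q<n. ?A $$ (q, n - 1) * cofactor ?A q (n - 1))"
    by (rule laplace_expansion_column) (use assms(1) in auto)
  also have "\<dots> = (\<Sum>q\<in>{q0}. ?A $$ (q, n - 1) * cofactor ?A q (n - 1))"
    using assms by (intro sum.mono_neutral_right) auto
  finally have "det ?A = f q0 (n - 1) * cofactor ?A q0 (n - 1)"
    using assms(1) by simp
  moreover have "mat_delete ?A q0 (n - 1) =
      mat (n - 1) (n - 1) (\<lambda>(q, l). f (if q < q0 then q else Suc q) l)"
    using assms(1) by (intro eq_matI) (auto simp: mat_delete_def)
  then have "cofactor ?A q0 (n - 1) = (-1) ^ (q0 + n - 1) *
      det (mat (n - 1) (n - 1) (\<lambda>(q, l). f (if q < q0 then q else Suc q) l))"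
    using assms(1) by (simp add: cofactor_def)
  ultimately show ?thesis
    by (simp add: mult_ac)
qed

lemma det_add_first_row:
  fixes f g h :: "nat \<Rightarrow> nat \<Rightarrow> 'a::comm_ring_1"
  assumes "0 < n" and "\<And>l. l < n \<Longrightarrow> f 0 l = g 0 l + x * h 0 l"
    and "\<And>q l. 0 < q \<Longrightarrow> q < n \<Longrightarrow> l < n \<Longrightarrow> g q l = f q l \<and> h q l = f q l"
  shows "det (mat n n (\<lambda>(q, l). f q l)) =
    det (mat n n (\<lambda>(q, l). g q l)) + x * det (mat n n (\<lambda>(q, l). h q l))"
proof -
  let ?M = "\<lambda>k. mat n n (\<lambda>(q, l). k q l)"
  have "cofactor (?M g) 0 l = cofactor (?M f) 0 l \<and> cofactor (?M h) 0 l = cofactor (?M f) 0 l" for l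
  proof -
    have "mat_delete (?M g) 0 l = mat_delete (?M f) 0 l" "mat_delete (?M h) 0 l = mat_delete (?M f) 0 l"
      using assms(1,3) by (auto simp: mat_delete_def intro!: eq_matI)
    then show ?thesis by (simp add: cofactor_def)
  qed
  moreover have "det (?M k) = (\<Sum>l<n. k 0 l * cofactor (?M k) 0 l)" for k :: "nat \<Rightarrow> nat \<Rightarrow> 'a"
    by (subst laplace_expansion_row[of _ n 0]) (use assms(1) in auto)
  ultimately show ?thesis
    using assms(1,2) by (simp add: sum.distrib distrib_right sum_distrib_left mult.assoc)
qed

lemma det_mult_lower_triangular:
  fixes G :: "nat \<Rightarrow> nat \<Rightarrow> 'a::comm_ring_1"
  assumes "\<And>c l. c < l \<Longrightarrow> l < n \<Longrightarrow> a c l = 0"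
  shows "det (mat n n (\<lambda>(q, l). \<Sum>c<n. G q c * a c l)) =
    det (mat n n (\<lambda>(q, c). G q c)) * (\<Prod>c<n. a c c)"
proof -
  have "mat n n (\<lambda>(q, l). \<Sum>c<n. G q c * a c l) =
      mat n n (\<lambda>(q, c). G q c) * mat n n (\<lambda>(c, l). a c l)"
    by (rule eq_matI) (auto simp: scalar_prod_def lessThan_atLeast0)
  moreover have "det (mat n n (\<lambda>(c, l). a c l)) = (\<Prod>c<n. a c c)"
    using assms by (subst det_lower_triangular[of n]) (auto simp: prod_list_diag_prod lessThan_atLeast0)
  ultimately show ?thesis
    by (simp add: det_mult[of _ n])
qed

text \<open>The row operation clears the last column outside the pivot row \<open>q0\<close>, which
  \<open>c q0 = 0\<close> leaves intact; Laplace expansion along this column then has one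
  term.\<close>

lemma det_eliminate_last_column:
  fixes f :: "nat \<Rightarrow> nat \<Rightarrow> 'a::comm_ring_1"
  assumes "q0 < n" and "c 0 = 0" and "c q0 = 0"
    and "\<And>q. q < n \<Longrightarrow> q \<noteq> q0 \<Longrightarrow> f q (n - 1) = c q * f (q - 1) (n - 1)"
  defines "g \<equiv> \<lambda>q l. f q l - c q * f (q - 1) l"
  shows "det (mat n n (\<lambda>(q, l). f q l)) = (-1) ^ (q0 + n - 1) * f q0 (n - 1) *
    det (mat (n - 1) (n - 1) (\<lambda>(q, l). g (if q < q0 then q else Suc q) l))"
proof -
  have "det (mat n n (\<lambda>(q, l). f q l)) = det (mat n n (\<lambda>(q, l). g q l))"
    unfolding g_def by (rule det_bidiagonal_row_op[of c, symmetric]) (rule assms(2))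
  also have "\<dots> = (-1) ^ (q0 + n - 1) * g q0 (n - 1) *
      det (mat (n - 1) (n - 1) (\<lambda>(q, l). g (if q < q0 then q else Suc q) l))"
    using assms(1,4) by (intro det_single_entry_last_column) (auto simp: g_def)
  finally show ?thesis
    by (simp add: g_def assms(3))
qed

subsection \<open>Clearing the last column\<close>

text \<open>The full graph \<open>F\<close> and the smaller graph \<open>L\<close> are compared
  here. They share \<open>free\<close>, \<open>left\<close>, \<open>up\<close> and
  \<open>rend\<close>, and differ in \<open>step\<close>, hence in \<open>harmonic\<close>,
  \<open>R_val\<close> and \<open>green\<close>.\<close>

locale permutation_of_interval =
  fixes r :: nat and \<pi> :: "nat \<Rightarrow> nat"
  assumes perm: "\<pi> permutes {1..r}"
begin

interpretation F: permuted_array r \<pi> True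
  by unfold_locales (rule perm)

interpretation L: permuted_array r \<pi> False
  by unfold_locales (rule perm)

definition reduced :: "nat \<Rightarrow> nat \<Rightarrow> laurent" where
  "reduced k b = (if pinv \<pi> r < k then wu r \<pi> k b - wn r \<pi> k r * wu r \<pi> (k - 1) b else wu r \<pi> k b)"

text \<open>
  Replacing \<open>n\<^sub>x (h(left x) + h(up x))\<close> by \<open>n\<^sub>x h(left x)\<close> at the entries \<open>x\<close> of the last column makes \<open>h\<close>
  harmonic for the graph without vertical steps there. At the ends of the rows this is the row
  operation that defines \<open>reduced\<close>.
\<close>

definition unlinked :: "(nat \<times> nat \<Rightarrow> laurent) \<Rightarrow> nat \<times> nat \<Rightarrow> laurent" where
  "unlinked h p = (if F.free p \<and> snd p = r then F.wt p * h (F.left p) else h p)"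

lemma snd_entry_le: "p \<in> entries r \<pi> \<Longrightarrow> snd p \<le> r"
  by (cases p) (simp add: F.entries_iff)

text \<open>Values change only at free entries of the last column. For \<open>p\<close> in that
  column the step up is dropped from the recursion; for other \<open>p\<close> neither neighbour
  lies in the last column.\<close>

lemma harmonic_unlinked:
  assumes "F.harmonic h"
  shows "L.harmonic (unlinked h)"
  unfolding L.harmonic_def
proof (intro allI impI)
  fix p assume free: "F.free p"
  have p: "snd p \<le> r"
    using free by (auto simp: F.free_def intro: snd_entry_le)
  have h: "h p = F.wt p * (h (F.left p) + (-1) ^ (fst p - Suc (fst (F.up p))) * h (F.up p))"
    using assms[unfolded F.harmonic_def, rule_format, OF free] by simp
  have "snd (F.left p) < r"
    using F.left_props(2)[OF free] p by simp
  then show "unlinked h p = F.wt p * (unlinked h (F.left p) +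
      (if False \<or> snd p \<noteq> r then (-1) ^ (fst p - Suc (fst (F.up p))) * unlinked h (F.up p) else 0))"
    using h free by (simp add: unlinked_def)
qed

lemma last_column_entry:
  assumes "pinv \<pi> r \<le> k" and "1 \<le> k" and "k \<le> r"
  shows "(k, r) \<in> entries r \<pi>" and "F.rend k = (k, r)"
proof -
  show entry: "(k, r) \<in> entries r \<pi>"
    using assms by (simp add: F.entries_iff)
  have "F.rend k \<in> entries r \<pi>" using assms by (intro F.rend_in)
  then have "snd (F.rend k) = r"
    using F.rend_ge[OF entry] snd_entry_le by (meson antisym)
  then show "F.rend k = (k, r)" by (simp add: prod_eq_iff)
qed

text \<open>Below \<open>1_r\<close> the last column has no zero entry, so the vertical step there
  moves by a single row and its sign is 1.\<close>

lemma last_column_free: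
  assumes "pinv \<pi> r < k" and "k \<le> r"
  shows "F.free (k, r)" and "F.up (k, r) = (k - 1, r)"
proof -
  have r: "1 \<le> r" using assms by simp
  then have "1 \<le> pinv \<pi> r" by simp
  then have "1 \<le> k - 1" using assms by linarith
  then have "(k, r) \<in> entries r \<pi>" "(k - 1, r) \<in> entries r \<pi>"
    using assms by (auto intro!: last_column_entry(1))
  moreover have "\<pi> k < r"
  proof (rule le_neq_implies_less)
    show "\<pi> k \<le> r" using assms by simp
    show "\<pi> k \<noteq> r" using assms by auto
  qed
  ultimately show free: "F.free (k, r)"
    by (simp add: F.free_def F.entries_iff)
  have "k - 1 \<le> fst (F.up (k, r))"
    using F.up_props(4)[OF free, of "k - 1"] \<open>(k - 1, r) \<in> entries r \<pi>\<close> assms by simp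
  then show "F.up (k, r) = (k - 1, r)"
    using F.up_props(2)[OF free] by (simp add: prod_eq_iff)
qed

lemma last_column_recursion:
  assumes "pinv \<pi> r < k" and "k \<le> r" and "1 \<le> b" and "b \<le> r"
  shows "wu r \<pi> k b = wn r \<pi> k r * (F.R_val b (F.left (k, r)) + wu r \<pi> (k - 1) b)"
proof -
  have "1 \<le> r" using assms by simp
  then have "1 \<le> pinv \<pi> r" by simp
  then have "1 \<le> k - 1" using assms by linarith
  then have "wu r \<pi> k b = F.R_val b (k, r)" "wu r \<pi> (k - 1) b = F.R_val b (k - 1, r)"
    using assms F.wu_eq_R_val[of k b] F.wu_eq_R_val[of "k - 1" b] last_column_entry(2) by simp_all
  moreover have "F.R_val b (k, r) = F.wt (k, r) * (F.R_val b (F.left (k, r)) + F.R_val b (k - 1, r))"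
    using F.harmonic_R_val[of b] assms last_column_free[of k] by (simp add: F.harmonic_def)
  ultimately show ?thesis
    by (simp add: F.wt_def)
qed

lemma reduced_eq_unlinked:
  assumes "1 \<le> k" and "k \<le> r" and "1 \<le> b" and "b \<le> r"
  shows "reduced k b = unlinked (F.R_val b) (F.rend k)"
proof (cases "pinv \<pi> r < k")
  case True
  then show ?thesis
    using assms last_column_recursion[of k b] last_column_entry(2)[of k] last_column_free(1)[of k]
    by (simp add: reduced_def unlinked_def F.wt_def distrib_left)
next
  case False
  have "\<not> (F.free (F.rend k) \<and> snd (F.rend k) = r)"
  proof
    assume free: "F.free (F.rend k) \<and> snd (F.rend k) = r"
    then have "(k, r) \<in> entries r \<pi>" "\<pi> k < r"
      unfolding F.free_def by (metis F.fst_rend prod.collapse)+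
    then have "k = pinv \<pi> r" using False by (simp add: F.entries_iff)
    then show False using \<open>\<pi> k < r\<close> by simp
  qed
  then show ?thesis
    using False assms F.wu_eq_R_val[of k b] by (auto simp: reduced_def unlinked_def)
qed

text \<open>For \<open>b = r\<close> the left neighbour contributes nothing, since
  \<open>R_val r\<close> is 0 left of the last column; the recursion leaves just the subtracted
  multiple of the row above.\<close>

lemma reduced_last:
  assumes "pinv \<pi> r < k" and "k \<le> r"
  shows "reduced k r = 0"
proof -
  have "snd (F.left (k, r)) < r"
    using F.left_props(2)[OF last_column_free(1)[OF assms]] by simp
  then have "F.R_val r (F.left (k, r)) = 0"
    by (simp add: F.R_val_def)
  then show ?thesis
    using last_column_recursion[of k r] assms by (simp add: reduced_def distrib_left)
qed

lemma wu_first_rows: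
  assumes "1 \<le> k" and "k < pinv \<pi> r" and "k \<le> r"
  shows "wu r \<pi> k r = 0"
  using assms F.wu_eq_R_val[of k r] by (simp add: F.R_val_def)

lemma wu_row_of_last_one: "wu r \<pi> (pinv \<pi> r) r = 1"
  by (simp add: wu_def u_entry_def n_entry_def Inv_def)

text \<open>By \<open>reduced_last\<close>, each entry of the column below \<open>1_r\<close> is the
  previous one times a unit of \<open>wn\<close>. This yields nonvanishing, which locates
  \<open>top_row\<close>, and invertibility of the variable by which \<open>det F\<close> is
  divided.\<close>

lemma wu_last_column_unit:
  assumes "pinv \<pi> r \<le> k" and "k \<le> r"
  shows "wu r \<pi> k r dvd 1"
  using assms
proof (induction k rule: dec_induct)
  case base
  then show ?case by (simp add: wu_row_of_last_one)
next
  case (step k)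
  have "wu r \<pi> (Suc k) r = wn r \<pi> (Suc k) r * wu r \<pi> k r"
    using reduced_last[of "Suc k"] step by (simp add: reduced_def)
  moreover have "wn r \<pi> (Suc k) r dvd 1"
    using F.wt_unit[OF last_column_entry(1)[of "Suc k"]] step unfolding F.wt_def dvd_def
    by (metis fst_conv le_SucI le_add1 plus_1_eq_Suc snd_conv)
  ultimately show ?case
    using step by (metis Suc_leD mult_dvd_mono mult_1)
qed

text \<open>
  Both matrices are the product of the same Green matrix with a triangular matrix of sink values, and
  the two triangular matrices have the same diagonal.
\<close>

lemma det_reduced:
  assumes "1 \<le> m" and "length ks = r - m" and "set ks \<subseteq> {1..r} - {pinv \<pi> r}"
  shows "det (mat_on reduced ks [m..<r]) = det (mat_on (xL r \<pi>) ks [m..<r])"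
proof -
  define G where "G q c = L.green (m + c) (F.rend (ks ! q))" for q c
  \<comment> \<open>Only the sinks in columns \<open>m\<close> to \<open>r - 1\<close> survive:
    those further left have boundary value 0, and \<open>1_r\<close> drops out by
    \<open>green_last\<close> because \<open>k\<close> is not its row.\<close>
  have expand: "\<phi> (F.rend k) = (\<Sum>c<r - m. L.green (m + c) (F.rend k) * \<phi> (pinv \<pi> (m + c), m + c))"
    if "L.harmonic \<phi>" "k \<in> set ks" "\<And>c. c < m \<Longrightarrow> \<phi> (pinv \<pi> c, c) = 0" for \<phi> k
  proof -
    have k: "1 \<le> k" "k \<le> r" "k \<noteq> pinv \<pi> r" using that assms(3) by auto
    then have "F.rend k \<in> entries r \<pi>" "F.rend k \<noteq> (pinv \<pi> r, r)"
      using F.rend_in[of k] F.fst_rend[of k] by (auto simp del: F.fst_rend)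
    then have last: "L.green r (F.rend k) = 0"
      by (intro L.green_last) auto
    have "\<phi> (F.rend k) = (\<Sum>c\<in>{1..r}. L.green c (F.rend k) * \<phi> (pinv \<pi> c, c))"
      using that(1) \<open>F.rend k \<in> entries r \<pi>\<close> by (rule L.harmonic_eq_green)
    also have "\<dots> = (\<Sum>c\<in>{m..<r}. L.green c (F.rend k) * \<phi> (pinv \<pi> c, c))"
      using assms(1) that(3) last by (intro sum.mono_neutral_right) (auto simp: not_le not_less le_less)
    also have "\<dots> = (\<Sum>c<r - m. L.green (m + c) (F.rend k) * \<phi> (pinv \<pi> (m + c), m + c))"
      by (rule sum.reindex_bij_witness[of _ "\<lambda>c. m + c" "\<lambda>c. c - m"]) auto
    finally show ?thesis .
  qed
  define a where "a c l = unlinked (F.R_val (m + l)) (pinv \<pi> (m + c), m + c)" for c l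
  define a' where "a' c l = L.R_val (m + l) (pinv \<pi> (m + c), m + c)" for c l
  have one: "unlinked h (pinv \<pi> c, c) = h (pinv \<pi> c, c)" for h c
    by (simp add: unlinked_def F.free_def)
  have "mat_on reduced ks [m..<r] = mat (r - m) (r - m) (\<lambda>(q, l). \<Sum>c<r - m. G q c * a c l)"
  proof (rule eq_matI)
    fix q l
    assume "q < dim_row (mat (r - m) (r - m) (\<lambda>(q, l). \<Sum>c<r - m. G q c * a c l))"
      and "l < dim_col (mat (r - m) (r - m) (\<lambda>(q, l). \<Sum>c<r - m. G q c * a c l))"
    then have ql: "q < r - m" "l < r - m" by simp_all
    then have k: "ks ! q \<in> set ks" using assms(2) by simp
    then have "ks ! q \<in> {1..r}" using assms(3) by blast
    have "reduced (ks ! q) (m + l) = unlinked (F.R_val (m + l)) (F.rend (ks ! q))"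
      using assms(1) \<open>ks ! q \<in> {1..r}\<close> ql by (intro reduced_eq_unlinked) auto
    also have "\<dots> = (\<Sum>c<r - m. G q c * a c l)"
      unfolding G_def a_def using assms(1) ql k
      by (intro expand harmonic_unlinked F.harmonic_R_val) (auto simp: one F.R_val_one)
    finally show "mat_on reduced ks [m..<r] $$ (q, l) =
        mat (r - m) (r - m) (\<lambda>(q, l). \<Sum>c<r - m. G q c * a c l) $$ (q, l)"
      using ql assms(2) by (simp add: mat_on_def)
  qed (use assms(2) in \<open>auto simp: mat_on_def\<close>)
  then have "det (mat_on reduced ks [m..<r]) =
      det (mat (r - m) (r - m) (\<lambda>(q, c). G q c)) * (\<Prod>c<r - m. a c c)"
    using det_mult_lower_triangular[of "r - m" a G] by (simp add: a_def one F.R_val_one)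
  moreover have "mat_on (xL r \<pi>) ks [m..<r] = mat (r - m) (r - m) (\<lambda>(q, l). \<Sum>c<r - m. G q c * a' c l)"
  proof (rule eq_matI)
    fix q l
    assume "q < dim_row (mat (r - m) (r - m) (\<lambda>(q, l). \<Sum>c<r - m. G q c * a' c l))"
      and "l < dim_col (mat (r - m) (r - m) (\<lambda>(q, l). \<Sum>c<r - m. G q c * a' c l))"
    then have ql: "q < r - m" "l < r - m" by simp_all
    then have k: "ks ! q \<in> set ks" using assms(2) by simp
    then have "ks ! q \<in> {1..r}" using assms(3) by blast
    have "xL r \<pi> (ks ! q) (m + l) = L.R_val (m + l) (F.rend (ks ! q))"
      using assms(1) \<open>ks ! q \<in> {1..r}\<close> ql by (intro L.xL_eq_R_val) auto
    also have "\<dots> = (\<Sum>c<r - m. G q c * a' c l)"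
      unfolding G_def a'_def using assms(1) ql k
      by (intro expand L.harmonic_R_val) (auto simp: L.R_val_one)
    finally show "mat_on (xL r \<pi>) ks [m..<r] $$ (q, l) =
        mat (r - m) (r - m) (\<lambda>(q, l). \<Sum>c<r - m. G q c * a' c l) $$ (q, l)"
      using ql assms(2) by (simp add: mat_on_def)
  qed (use assms(2) in \<open>auto simp: mat_on_def\<close>)
  then have "det (mat_on (xL r \<pi>) ks [m..<r]) =
      det (mat (r - m) (r - m) (\<lambda>(q, c). G q c)) * (\<Prod>c<r - m. a' c c)"
    using det_mult_lower_triangular[of "r - m" a' G] by (simp add: a'_def L.R_val_one)
  \<comment> \<open>Both diagonals consist of the inverses of \<open>\<rho>(1_b)\<close>, which do
    not see the vertical steps.\<close>
  moreover have "(\<Prod>c<r - m. a c c) = (\<Prod>c<r - m. a' c c)"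
    using assms(1) by (intro prod.cong) (simp_all add: a_def a'_def one F.R_val_one_self L.R_val_one_self)
  ultimately show ?thesis by simp
qed

end

section \<open>Determinants of row selections with one pivot in the last column\<close>

context permutation_of_interval
begin

text \<open>The common form of all the expansions, with the pivot at position \<open>q0\<close> of
  the row list \<open>ks\<close>. Every other row either is already reduced with last entry 0, or
  follows directly on the row of \<open>wu\<close> above it, so that subtracting a multiple of its
  predecessor produces \<open>reduced\<close>.\<close>

lemma det_rows:
  assumes "m + n = r + 1" and "1 \<le> m" and "q0 < n" and "length ks = n"
    and set: "set (take q0 ks @ drop (Suc q0) ks) \<subseteq> {1..r} - {pinv \<pi> r}"
    and rows: "\<And>q. q < n \<Longrightarrow> q \<noteq> q0 \<Longrightarrow>
      (\<forall>l<n. f q l = reduced (ks ! q) (m + l)) \<and> f q (n - 1) = 0 \<or>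
      0 < q \<and> pinv \<pi> r < ks ! q \<and>
        (\<forall>l<n. f q l = wu r \<pi> (ks ! q) (m + l) \<and> f (q - 1) l = wu r \<pi> (ks ! q - 1) (m + l))"
  shows "det (mat n n (\<lambda>(q, l). f q l)) = (-1) ^ (q0 + n - 1) * f q0 (n - 1) *
    det (mat_on (xL r \<pi>) (take q0 ks @ drop (Suc q0) ks) [m..<r])"
proof -
  define P where "P q \<longleftrightarrow> (\<forall>l<n. f q l = reduced (ks ! q) (m + l)) \<and> f q (n - 1) = 0" for q
  \<comment> \<open>The multiplier is 0 at the pivot and at rows already reduced. In particular
    \<open>c 0 = 0\<close>, as the second kind of row requires \<open>0 < q\<close>.\<close>
  define c where "c q = (if q = q0 \<or> P q then 0 else wn r \<pi> (ks ! q) r)" for q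
  define js where "js = take q0 ks @ drop (Suc q0) ks"
  have js: "length js = n - 1" "\<And>q. q < n - 1 \<Longrightarrow> js ! q = ks ! (if q < q0 then q else Suc q)"
    using assms(3,4) by (auto simp: js_def nth_append)
  have r: "m + (n - 1) = r" "n - 1 = r - m" using assms(1,3) by linarith+
  have range: "ks ! q \<in> {1..r} - {pinv \<pi> r}" if "q < n" "q \<noteq> q0" for q
  proof -
    define q' where "q' = (if q < q0 then q else q - 1)"
    have "q' < n - 1" "(if q' < q0 then q' else Suc q') = q"
      using that assms(3) by (auto simp: q'_def)
    then have "ks ! q \<in> set js" using js by (metis nth_mem)
    then show ?thesis using set by (auto simp: js_def)
  qed
  have reduce: "f q l - c q * f (q - 1) l = reduced (ks ! q) (m + l)" if "q < n" "q \<noteq> q0" "l < n" for q l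
  proof (cases "P q")
    case True
    then show ?thesis using that by (simp add: c_def P_def)
  next
    case False
    then have "pinv \<pi> r < ks ! q"
      "f q l = wu r \<pi> (ks ! q) (m + l)" "f (q - 1) l = wu r \<pi> (ks ! q - 1) (m + l)"
      using rows[OF that(1,2)] that(3) unfolding P_def by blast+
    moreover have "c q = wn r \<pi> (ks ! q) r" using False that by (simp add: c_def)
    ultimately show ?thesis by (simp only: reduced_def if_True)
  qed
  have "det (mat n n (\<lambda>(q, l). f q l)) = (-1) ^ (q0 + n - 1) * f q0 (n - 1) *
    det (mat (n - 1) (n - 1) (\<lambda>(q, l). f (if q < q0 then q else Suc q) l -
      c (if q < q0 then q else Suc q) * f ((if q < q0 then q else Suc q) - 1) l))"
  proof (rule det_eliminate_last_column[OF assms(3)])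
    show "c 0 = 0"
      using rows[of 0] assms(3) by (auto simp: c_def P_def)
    show "f q (n - 1) = c q * f (q - 1) (n - 1)" if q: "q < n" "q \<noteq> q0" for q
    proof (cases "P q")
      case True
      then show ?thesis by (simp add: c_def P_def)
    next
      case False
      then have "pinv \<pi> r < ks ! q"
        using rows[OF q] by (auto simp: P_def)
      then have "reduced (ks ! q) r = 0"
        using range[OF q] by (intro reduced_last) auto
      then show ?thesis
        using reduce[OF q, of "n - 1"] r assms(3) by simp
    qed
  qed (simp add: c_def)
  also have "mat (n - 1) (n - 1) (\<lambda>(q, l). f (if q < q0 then q else Suc q) l -
      c (if q < q0 then q else Suc q) * f ((if q < q0 then q else Suc q) - 1) l) =
      mat_on reduced js [m..<r]"
  proof (rule eq_matI)
    fix q l assume "q < dim_row (mat_on reduced js [m..<r])" "l < dim_col (mat_on reduced js [m..<r])"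
    then have ql: "q < n - 1" "l < n - 1" using js(1) r by (simp_all add: mat_on_def)
    define q' where "q' = (if q < q0 then q else Suc q)"
    have "q' < n" "q' \<noteq> q0" "js ! q = ks ! q'" using ql js by (auto simp: q'_def)
    then have "f q' l - c q' * f (q' - 1) l = reduced (js ! q) (m + l)"
      using reduce[of q' l] ql by simp
    then show "mat (n - 1) (n - 1) (\<lambda>(q, l). f (if q < q0 then q else Suc q) l -
        c (if q < q0 then q else Suc q) * f ((if q < q0 then q else Suc q) - 1) l) $$ (q, l) =
        mat_on reduced js [m..<r] $$ (q, l)"
      using ql js(1) r by (simp add: mat_on_def flip: q'_def)
  qed (use js r in \<open>simp_all add: mat_on_def\<close>)
  also have "det (mat_on reduced js [m..<r]) = det (mat_on (xL r \<pi>) js [m..<r])"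
    using assms(2) js(1) r set by (intro det_reduced) (auto simp: js_def)
  finally show ?thesis by (simp add: js_def)
qed

lemma wu_eq_reduced:
  assumes "k < pinv \<pi> r"
  shows "wu r \<pi> k b = reduced k b"
  using assms by (simp add: reduced_def)

end

lemma filter_neq_upt: "m \<le> p \<Longrightarrow> p < n \<Longrightarrow> [k\<leftarrow>[m..<n]. k \<noteq> p] = [m..<p] @ [Suc p..<n]"
proof -
  assume "m \<le> p" "p < n"
  then have "[m..<n] = [m..<p] @ p # [Suc p..<n]"
    by (metis le_add_diff_inverse less_imp_le_nat upt_add_eq_append upt_conv_Cons)
  then show ?thesis by simp
qed

lemma top_row_eq:
  assumes "q0 < i" and "i \<le> r" and "wu r \<pi> (r - i + 1 + q0) r \<noteq> 0"
    and "\<And>q. q < q0 \<Longrightarrow> wu r \<pi> (r - i + 1 + q) r = 0"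
  shows "top_row r \<pi> i = Suc q0"
proof -
  have entry: "T_mat r \<pi> i $$ (q, i - 1) = wu r \<pi> (r - i + 1 + q) r" if "q < i" for q
    using that assms(2) by (simp add: T_mat_def mat_on_def del: upt_Suc)
  show ?thesis
    unfolding top_row_def
  proof (rule Least_equality)
    show "1 \<le> Suc q0 \<and> Suc q0 \<le> i \<and> T_mat r \<pi> i $$ (Suc q0 - 1, i - 1) \<noteq> 0"
      using assms(1,3) entry by simp
    fix s assume s: "1 \<le> s \<and> s \<le> i \<and> T_mat r \<pi> i $$ (s - 1, i - 1) \<noteq> 0"
    show "Suc q0 \<le> s"
    proof (rule ccontr)
      assume "\<not> Suc q0 \<le> s"
      then have "s - 1 < q0" "s - 1 < i" using s assms(1) by linarith+
      then show False using entry[of "s - 1"] assms(4)[of "s - 1"] s by simp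
    qed
  qed
qed

theorem proposition1p16:
  fixes r i s :: nat and \<pi> :: "nat \<Rightarrow> nat"
  assumes "r \<ge> 2" and "\<pi> permutes {1..r}"
    and "1 \<le> i" and "i \<le> r" and "r - i + 1 > \<pi> r"
    and "s = top_row r \<pi> i"
  shows "det (T_mat r \<pi> i) = (-1) ^ (s + i) * u_entry r \<pi> (\<pi> (r - i + s)) r * det (TL_mat r \<pi> i) \<and>
    det (F_mat r \<pi> i) =
      (if r - i + 1 > pinv \<pi> r then
         unit_inv (n_entry r \<pi> (\<pi> (r - i + 1)) r) * det (T_mat r \<pi> i)
         - (-1) ^ i * unit_inv (n_entry r \<pi> (\<pi> (r - i + 1)) r)
             * u_entry r \<pi> (\<pi> (r - i + 2)) r * det (FL_mat r \<pi> i)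
       else if r - i + 1 = pinv \<pi> r then
         (-1) ^ i * u_entry r \<pi> (\<pi> (r - i + 2)) r * det (FL_mat r \<pi> i)
       else (-1) ^ (r - pinv \<pi> r) * det (FL_mat r \<pi> i))"
proof -
  interpret permutation_of_interval r \<pi>
    by unfold_locales (rule assms(2))
  \<comment> \<open>\<open>t\<close> is the first row and column of \<open>T_mat\<close>, and
    \<open>p\<close> is the row of \<open>1_r\<close>; the three cases of (ii) are
    \<open>p < t\<close>, \<open>t = p\<close> and \<open>t < p\<close>.\<close>
  define t where "t = r - i + 1"
  define p where "p = pinv \<pi> r"
  have "p \<in> {1..r}" "\<pi> r \<in> {1..r}"
    using permutes_in_image[OF permutes_inv[OF assms(2)], of r] permutes_in_image[OF assms(2), of r]
      assms(1) by (auto simp: p_def)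
  then have p: "1 \<le> p" "p \<le> r" and t: "2 \<le> t" "t + i = r + 1" "r - i = t - 1" "1 \<le> i"
    using assms(3-5) by (auto simp: t_def)
  \<comment> \<open>For \<open>i = 1\<close> the assumption on \<open>\<pi> r\<close> says that
    \<open>r\<close> is not fixed, so \<open>p\<close> differs from \<open>r = t\<close>. Thus in
    the case \<open>t = p\<close> a row \<open>t + 1\<close> exists.\<close>
  have "p \<noteq> r \<or> 2 \<le> i"
  proof (rule disjCI)
    assume "\<not> 2 \<le> i"
    then have "\<pi> r \<noteq> r" using assms(3-5) by auto
    then show "p \<noteq> r" using permutes_inverses(1)[OF assms(2), of r] by (auto simp: p_def)
  qed
  then have tp: "t = p \<Longrightarrow> 2 \<le> i" using t p(2) by auto
  let ?f = "\<lambda>q l. wu r \<pi> (t + q) (t + l)" and ?h = "\<lambda>q l. wu r \<pi> (if q = 0 then t - 1 else t + q) (t + l)"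
  have last: "t + (i - 1) = r" using t assms(3) by linarith
  have nth: "[t..<r + 1] ! q = t + q" "((t - 1) # [t + 1..<r + 1]) ! q = (if q = 0 then t - 1 else t + q)"
    if "q < i" for q
    using that t by (auto simp: nth_Cons' simp del: upt_Suc)
  have T: "T_mat r \<pi> i = mat i i (\<lambda>(q, l). ?f q l)"
    unfolding T_mat_def t_def[symmetric] mat_on_def using t by (intro cong_mat) (auto simp del: upt_Suc)
  have "[k\<leftarrow>[t - 1..<r + 1]. k \<noteq> t] = (t - 1) # [t + 1..<r + 1]"
    using t filter_neq_upt[of "t - 1" t "r + 1"] assms(3)
    by (simp del: upt_Suc) (simp add: upt_conv_Cons)
  then have F: "F_mat r \<pi> i = mat i i (\<lambda>(q, l). ?h q l)"
    unfolding F_mat_def t_def[symmetric] t(3) mat_on_def using t nth(2) assms(3)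
    by (intro cong_mat) (auto simp del: upt_Suc)
  have FL: "FL_mat r \<pi> i = mat_on (xL r \<pi>) (if p < t then t # [t + 2..<r + 1]
      else if t = p then (t - 1) # [t + 2..<r + 1] else (t - 1) # [k\<leftarrow>[t + 1..<r + 1]. k \<noteq> p]) [t..<r]"
  proof -
    have "r - i + 1 = t" "r - i + 2 = t + 1" "r - i + 3 = t + 2" by (simp_all add: t_def)
    then show ?thesis by (simp only: FL_mat_def p_def t(3))
  qed
  have zero: "wu r \<pi> k r = 0" if "1 \<le> k" "k < p" for k
    using wu_first_rows[of k] that p by (simp add: p_def)
  have nonzero: "wu r \<pi> k r \<noteq> 0" if "p \<le> k" "k \<le> r" for k
    using wu_last_column_unit[of k] that by (auto simp: p_def)

  have detT: "det (T_mat r \<pi> i) = (-1) ^ (s + i) * u_entry r \<pi> (\<pi> (r - i + s)) r * det (TL_mat r \<pi> i)"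
  proof -
    \<comment> \<open>Truncated subtraction: the pivot is the row of \<open>1_r\<close> if that row
      belongs to \<open>T_mat\<close>, and the first row if \<open>p < t\<close>, when the whole
      last column is nonzero.\<close>
    define q0 where "q0 = p - t"
    have q0: "q0 < i" using p t by (simp add: q0_def)
    have s: "s = Suc q0"
      unfolding assms(6)
    proof (rule top_row_eq[OF q0 assms(4)])
      show "wu r \<pi> (r - i + 1 + q0) r \<noteq> 0"
        using p t by (intro nonzero) (auto simp: q0_def)
      show "wu r \<pi> (r - i + 1 + q) r = 0" if "q < q0" for q
        using that t by (intro zero) (auto simp: q0_def)
    qed
    have ks: "take q0 [t..<r + 1] @ drop (Suc q0) [t..<r + 1] =
        (if t > p then [r - i + 2..<r + 1] else [k\<leftarrow>[t..<r + 1]. k \<noteq> p])"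
      using filter_neq_upt[of t p "r + 1"] p t by (auto simp: q0_def drop_upt take_upt simp del: upt_Suc)
    have "det (T_mat r \<pi> i) = (-1) ^ (q0 + i - 1) * ?f q0 (i - 1) *
        det (mat_on (xL r \<pi>) (take q0 [t..<r + 1] @ drop (Suc q0) [t..<r + 1]) [t..<r])"
      unfolding T
    proof (rule det_rows)
      show "set (take q0 [t..<r + 1] @ drop (Suc q0) [t..<r + 1]) \<subseteq> {1..r} - {pinv \<pi> r}"
        unfolding ks using t by (auto simp: p_def)
      \<comment> \<open>Rows above the pivot end in 0 and are reduced as they stand; rows after it
        lie below \<open>1_r\<close> and are reduced by their predecessor.\<close>
      fix q assume q: "q < i" "q \<noteq> q0"
      show "(\<forall>l<i. ?f q l = reduced ([t..<r + 1] ! q) (t + l)) \<and> ?f q (i - 1) = 0 \<or>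
        0 < q \<and> pinv \<pi> r < [t..<r + 1] ! q \<and>
        (\<forall>l<i. ?f q l = wu r \<pi> ([t..<r + 1] ! q) (t + l) \<and> ?f (q - 1) l = wu r \<pi> ([t..<r + 1] ! q - 1) (t + l))"
        unfolding nth(1)[OF q(1)]
      proof (cases "q < q0")
        case True
        then have lt: "t + q < p" by (simp add: q0_def)
        then have "?f q (i - 1) = 0" using zero[of "t + q"] t(1) last by simp
        then show "(\<forall>l<i. ?f q l = reduced (t + q) (t + l)) \<and> ?f q (i - 1) = 0 \<or>
            0 < q \<and> pinv \<pi> r < t + q \<and>
            (\<forall>l<i. ?f q l = wu r \<pi> (t + q) (t + l) \<and> ?f (q - 1) l = wu r \<pi> (t + q - 1) (t + l))"
          using wu_eq_reduced[OF lt[unfolded p_def]] by blast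
      next
        case False
        then have "pinv \<pi> r < t + q"
          using q(2) by (simp add: q0_def p_def)
        moreover have "q = Suc (q - 1)"
          using False q(2) by linarith
        then obtain q' where "q = Suc q'" by blast
        ultimately show "(\<forall>l<i. ?f q l = reduced (t + q) (t + l)) \<and> ?f q (i - 1) = 0 \<or>
            0 < q \<and> pinv \<pi> r < t + q \<and>
            (\<forall>l<i. ?f q l = wu r \<pi> (t + q) (t + l) \<and> ?f (q - 1) l = wu r \<pi> (t + q - 1) (t + l))"
          by simp
      qed
    qed (use t q0 in auto)
    moreover have "TL_mat r \<pi> i = mat_on (xL r \<pi>) (take q0 [t..<r + 1] @ drop (Suc q0) [t..<r + 1]) [t..<r]"
      unfolding TL_mat_def ks by (simp add: t_def p_def)
    moreover have "(-1 :: laurent) ^ (q0 + i - 1) = (-1) ^ (s + i)"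
      using s assms(3) by (cases i) simp_all
    moreover have "?f q0 (i - 1) = u_entry r \<pi> (\<pi> (r - i + s)) r"
      using last s t by (simp add: wu_def)
    ultimately show ?thesis by simp
  qed
  moreover have "det (F_mat r \<pi> i) = (-1) ^ (r - p) * det (FL_mat r \<pi> i)" if "t < p"
  proof -
    \<comment> \<open>In \<open>F_mat\<close> row \<open>t - 1\<close> takes the place of row
      \<open>t\<close>, so the later positions are as in \<open>T_mat\<close>. The pivot is
      \<open>1_r\<close> itself, with entry 1.\<close>
    define q0 where "q0 = p - t"
    let ?ks = "(t - 1) # [t + 1..<r + 1]"
    have q0: "0 < q0" "q0 < i" using p t that by (auto simp: q0_def)
    have "take q0 ?ks @ drop (Suc q0) ?ks = (t - 1) # take (q0 - 1) [t + 1..<r + 1] @ drop q0 [t + 1..<r + 1]"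
      using q0 by (cases q0) auto
    also have "\<dots> = (t - 1) # [k\<leftarrow>[t + 1..<r + 1]. k \<noteq> p]"
      using filter_neq_upt[of "t + 1" p "r + 1"] p that by (auto simp: q0_def drop_upt take_upt simp del: upt_Suc)
    finally have ks: "take q0 ?ks @ drop (Suc q0) ?ks = (t - 1) # [k\<leftarrow>[t + 1..<r + 1]. k \<noteq> p]" .
    have "det (F_mat r \<pi> i) = (-1) ^ (q0 + i - 1) * ?h q0 (i - 1) *
        det (mat_on (xL r \<pi>) (take q0 ?ks @ drop (Suc q0) ?ks) [t..<r])"
      unfolding F
    proof (rule det_rows)
      show "set (take q0 ?ks @ drop (Suc q0) ?ks) \<subseteq> {1..r} - {pinv \<pi> r}"
        unfolding ks using t that p by (auto simp: p_def)
      fix q assume q: "q < i" "q \<noteq> q0"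
      show "(\<forall>l<i. ?h q l = reduced (?ks ! q) (t + l)) \<and> ?h q (i - 1) = 0 \<or>
        0 < q \<and> pinv \<pi> r < ?ks ! q \<and>
        (\<forall>l<i. ?h q l = wu r \<pi> (?ks ! q) (t + l) \<and> ?h (q - 1) l = wu r \<pi> (?ks ! q - 1) (t + l))"
      proof (cases "q < q0")
        case True
        define k where "k = (if q = 0 then t - 1 else t + q)"
        have k: "?ks ! q = k" "1 \<le> k" "k < p"
          unfolding nth(2)[OF q(1)] using True that t(1) by (auto simp: k_def q0_def)
        then have "?h q (i - 1) = 0" using zero[of k] last by (simp add: k_def)
        moreover have "\<forall>l<i. ?h q l = reduced (?ks ! q) (t + l)"
          using k(1) wu_eq_reduced[OF k(3)[unfolded p_def]] by (simp add: k_def)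
        ultimately show ?thesis by blast
      next
        case False
        then have "pinv \<pi> r < t + q"
          using q(2) by (simp add: q0_def p_def)
        moreover have "q = Suc (Suc (q - 2))"
          using False q(2) q0(1) by linarith
        then obtain q' where "q = Suc (Suc q')" by blast
        ultimately show ?thesis unfolding nth(2)[OF q(1)] by simp
      qed
    qed (use t q0 in auto)
    moreover have "FL_mat r \<pi> i = mat_on (xL r \<pi>) (take q0 ?ks @ drop (Suc q0) ?ks) [t..<r]"
      unfolding FL ks using that by simp
    moreover have "?h q0 (i - 1) = 1"
      using q0 that last wu_row_of_last_one by (simp add: q0_def p_def)
    moreover have "(-1 :: laurent) ^ (q0 + i - 1) = (-1) ^ (r - p)"
    proof -
      have "q0 + i - 1 + (r - p) = 2 * (i - 1)"
        using that t p assms(3) by (simp add: q0_def)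
      then have "even (q0 + i - 1 + (r - p))" by simp
      then have "even (q0 + i - 1) = even (r - p)" by (simp only: even_add)
      then show ?thesis by (simp add: minus_one_power_iff)
    qed
    ultimately show ?thesis by simp
  qed
  moreover have "det (F_mat r \<pi> i) = (-1) ^ i * u_entry r \<pi> (\<pi> (r - i + 2)) r * det (FL_mat r \<pi> i)" if "t = p"
  proof -
    \<comment> \<open>The row of \<open>1_r\<close> is left out of \<open>F_mat\<close>, and row
      \<open>t - 1\<close> above it ends in 0. The pivot is therefore row \<open>t + 1\<close>, at
      position 1.\<close>
    let ?ks = "(t - 1) # [t + 1..<r + 1]"
    have i: "2 \<le> i" using tp that by simp
    then have ks: "take 1 ?ks @ drop (Suc 1) ?ks = (t - 1) # [t + 2..<r + 1]"
      by (simp add: drop_upt del: upt_Suc)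
    have "det (F_mat r \<pi> i) = (-1) ^ (1 + i - 1) * ?h 1 (i - 1) *
        det (mat_on (xL r \<pi>) (take 1 ?ks @ drop (Suc 1) ?ks) [t..<r])"
      unfolding F
    proof (rule det_rows)
      show "set (take 1 ?ks @ drop (Suc 1) ?ks) \<subseteq> {1..r} - {pinv \<pi> r}"
        unfolding ks using t that p by (auto simp: p_def)
      fix q assume q: "q < i" "q \<noteq> 1"
      show "(\<forall>l<i. ?h q l = reduced (?ks ! q) (t + l)) \<and> ?h q (i - 1) = 0 \<or>
        0 < q \<and> pinv \<pi> r < ?ks ! q \<and>
        (\<forall>l<i. ?h q l = wu r \<pi> (?ks ! q) (t + l) \<and> ?h (q - 1) l = wu r \<pi> (?ks ! q - 1) (t + l))"
      proof (cases "q = 0")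
        case True
        have k: "?ks ! q = t - 1" "1 \<le> t - 1" "t - 1 < p"
          using True that t(1) by auto
        then have "?h q (i - 1) = 0" using zero[of "t - 1"] last True by simp
        moreover have "\<forall>l<i. ?h q l = reduced (?ks ! q) (t + l)"
          using k(1) wu_eq_reduced[OF k(3)[unfolded p_def]] True by simp
        ultimately show ?thesis by blast
      next
        case False
        then have "q = Suc (Suc (q - 2))" using q(2) by linarith
        then obtain q' where "q = Suc (Suc q')" by blast
        then show ?thesis unfolding nth(2)[OF q(1)] using that by (simp add: p_def)
      qed
    qed (use t i in auto)
    moreover have "FL_mat r \<pi> i = mat_on (xL r \<pi>) (take 1 ?ks @ drop (Suc 1) ?ks) [t..<r]"
      unfolding FL ks using that by simp
    moreover have "?h 1 (i - 1) = u_entry r \<pi> (\<pi> (r - i + 2)) r"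
      using last by (simp add: wu_def t_def)
    ultimately show ?thesis by simp
  qed
  moreover have "det (F_mat r \<pi> i) = unit_inv (n_entry r \<pi> (\<pi> t) r) * det (T_mat r \<pi> i)
      - (-1) ^ i * unit_inv (n_entry r \<pi> (\<pi> t) r) * u_entry r \<pi> (\<pi> (r - i + 2)) r * det (FL_mat r \<pi> i)"
    if "p < t"
  proof -
    \<comment> \<open>Row \<open>t\<close> of \<open>wu\<close> is \<open>reduced t\<close> plus
      \<open>wn r \<pi> t r\<close> times row \<open>t - 1\<close>, the first row of
      \<open>F_mat\<close>; the other rows of \<open>T_mat\<close> and \<open>F_mat\<close> agree.
      So \<open>det T\<close> splits into the determinant of \<open>?g\<close> and a multiple of
      \<open>det F\<close>.\<close>
    let ?g = "\<lambda>q l. if q = 0 then reduced t (t + l) else wu r \<pi> (t + q) (t + l)"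
    have x: "wn r \<pi> t r * unit_inv (wn r \<pi> t r) = 1"
    proof (rule unit_inv_mult)
      have "wu r \<pi> t r = wn r \<pi> t r * wu r \<pi> (t - 1) r"
        using reduced_last[of t] that t assms(3) by (simp add: reduced_def p_def)
      then show "wn r \<pi> t r dvd 1"
        using wu_last_column_unit[of t] that t assms(3) by (metis add_leE dvd_mult_left le_add1 less_imp_le p_def last)
    qed
    have "det (T_mat r \<pi> i) = det (mat i i (\<lambda>(q, l). ?g q l)) + wn r \<pi> t r * det (F_mat r \<pi> i)"
      unfolding T F using assms(3) that by (intro det_add_first_row) (auto simp: reduced_def p_def)
    moreover have "det (mat i i (\<lambda>(q, l). ?g q l)) =
        (-1) ^ i * u_entry r \<pi> (\<pi> (r - i + 2)) r * det (FL_mat r \<pi> i)"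
    proof (cases "i = 1")
      \<comment> \<open>There is no second row: \<open>?g\<close> gives the 1 by 1 zero matrix, and
        the entry with index \<open>\<pi> (r + 1) = r + 1\<close> is 0 by default.\<close>
      case True
      then have "t = r" using t by simp
      then have "det (mat i i (\<lambda>(q, l). ?g q l)) = 0"
        using True reduced_last[of t] that by (simp add: det_single p_def)
      moreover have "u_entry r \<pi> (\<pi> (r - i + 2)) r = 0"
        using True assms(1) permutes_not_in[OF assms(2), of "Suc r"] by (simp add: u_entry_def n_entry_def Inv_def)
      ultimately show ?thesis by simp
    next
      case False
      then have i: "2 \<le> i" using assms(3) by simp
      then have ks: "take 1 [t..<r + 1] @ drop (Suc 1) [t..<r + 1] = t # [t + 2..<r + 1]"
        using t by (simp add: drop_upt upt_conv_Cons del: upt_Suc)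
      \<comment> \<open>The first row of \<open>?g\<close> ends in 0, and from position 2 on each
        row has its predecessor in \<open>wu\<close> above it, so the pivot is row
        \<open>t + 1\<close>.\<close>
      have "det (mat i i (\<lambda>(q, l). ?g q l)) = (-1) ^ (1 + i - 1) * ?g 1 (i - 1) *
          det (mat_on (xL r \<pi>) (take 1 [t..<r + 1] @ drop (Suc 1) [t..<r + 1]) [t..<r])"
      proof (rule det_rows)
        show "set (take 1 [t..<r + 1] @ drop (Suc 1) [t..<r + 1]) \<subseteq> {1..r} - {pinv \<pi> r}"
          unfolding ks using t that i by (auto simp: p_def)
        fix q assume q: "q < i" "q \<noteq> 1"
        show "(\<forall>l<i. ?g q l = reduced ([t..<r + 1] ! q) (t + l)) \<and> ?g q (i - 1) = 0 \<or>
          0 < q \<and> pinv \<pi> r < [t..<r + 1] ! q \<and>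
          (\<forall>l<i. ?g q l = wu r \<pi> ([t..<r + 1] ! q) (t + l) \<and> ?g (q - 1) l = wu r \<pi> ([t..<r + 1] ! q - 1) (t + l))"
        proof (cases "q = 0")
          case True
          have "reduced t r = 0"
            using that t by (intro reduced_last) (auto simp: p_def)
          then have "?g q (i - 1) = 0" using True last by simp
          moreover have "\<forall>l<i. ?g q l = reduced ([t..<r + 1] ! q) (t + l)"
            unfolding nth(1)[OF q(1)] using True by simp
          ultimately show ?thesis by blast
        next
          case False
          then have "q = Suc (Suc (q - 2))" using q(2) by linarith
          then obtain q' where "q = Suc (Suc q')" by blast
          then show ?thesis unfolding nth(1)[OF q(1)] using that by (simp add: p_def)
        qed
      qed (use t i in auto)
      moreover have "FL_mat r \<pi> i = mat_on (xL r \<pi>) (take 1 [t..<r + 1] @ drop (Suc 1) [t..<r + 1]) [t..<r]"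
        unfolding FL ks using that by simp
      moreover have "?g 1 (i - 1) = u_entry r \<pi> (\<pi> (r - i + 2)) r"
        using last by (simp add: wu_def t_def)
      ultimately show ?thesis by simp
    qed
    ultimately have "wn r \<pi> t r * det (F_mat r \<pi> i) =
        det (T_mat r \<pi> i) - (-1) ^ i * u_entry r \<pi> (\<pi> (r - i + 2)) r * det (FL_mat r \<pi> i)"
      by (simp add: algebra_simps)
    then have "unit_inv (wn r \<pi> t r) * (wn r \<pi> t r * det (F_mat r \<pi> i)) = unit_inv (wn r \<pi> t r) *
        (det (T_mat r \<pi> i) - (-1) ^ i * u_entry r \<pi> (\<pi> (r - i + 2)) r * det (FL_mat r \<pi> i))"
      by simp
    moreover have "unit_inv (wn r \<pi> t r) * (wn r \<pi> t r * y) = y" for y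
      using x by (metis mult.assoc mult.commute mult_1)
    ultimately show ?thesis
      by (simp add: wn_def right_diff_distrib mult_ac)
  qed
  ultimately show ?thesis
    by (auto simp: t_def p_def)
qed

end
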